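(* Let $\mathcal{C}$ be a crystal framework in $\mathbb{R}^d$ ($d\ge 2$) and fix a periodic structure $a_1,\dots,a_d$ and a motif $(F_v,F_e)$ for it, with $n=|F_v|$, $m=|F_e|$. The following statements are equivalent. (i) $\mathcal{C}$ is first-order rigid, i.e. $\mathcal{F}(\mathcal{C};\mathbb{C})=\mathcal{F}_{\rm rig}(\mathcal{C};\mathbb{C})$. (ii) $\mathcal{C}$ is exponentially rigid, i.e. $\mathcal{F}_{\rm exp}(\mathcal{C};\mathbb{C})=\mathcal{F}_{\rm rig}(\mathcal{C};\mathbb{C})$. (iii) For the given periodic structure, every factor-periodic flex of $\mathcal{C}$ and every flexible lattice periodic flex of $\mathcal{C}$ lies in $\mathcal{F}_{\rm rig}(\mathcal{C};\mathbb{C})$ (there are no nontrivial ones). (iv) The transfer function $\Psi_{\mathcal{C}}(z)$ and the matrix $R_{\rm fper}(\mathcal{C})$ are rank extremal, i.e. $\operatorname{rank}\Psi_{\mathcal{C}}(z)=dn$ for all $z\in(\mathbb{C}\setminus\{0\})^d\setminus\{(1,\dots,1)\}$, $\operatorname{rank}\Psi_{\mathcal{C}}(1,\dots,1)=dn-d$, and $\operatorname{rank}R_{\rm fper}(\mathcal{C})=dn+d(d-1)/2$. (v) The $\mathbb{C}(z)$-module $M(\mathcal{C})$ equals the rigidity module $M_{\rm rig}(\mathcal{C})$.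
   Context: A crystal framework $\mathcal{C}=(G,p)$ in $\mathbb{R}^d$ consists of a countable simple graph $G=(V,E)$ and an injective placement $p:V\to\mathbb{R}^d$ such that, for some linearly independent vectors $a_1,\dots,a_d\in\mathbb{R}^d$ (a periodic structure), $\mathbb{Z}^d$ acts on $G$ by graph automorphisms $v\mapsto k\cdot v$ with $p(k\cdot v)=p(v)+k_1a_1+\dots+k_da_d$, with finitely many orbits of vertices and of edges. A motif is a set $F_v=\{v_1,\dots,v_n\}$ of orbit representatives of vertices and a set $F_e$ of $m$ orbit representatives of edges. Write $(v,k)$ for the vertex $k\cdot v$ ($v\in F_v$, $k\in\mathbb{Z}^d$); each motif edge is written $e=(v,k)(w,l)$ with $v,w\in F_v$, and $p(e)=p(v,k)-p(w,l)\in\mathbb{R}^d$ (a row vector). A complex velocity field is a map $u:V\to\mathbb{C}^d$, identified with $u\in C(\mathbb{Z}^d;\mathbb{C}^{dn})$ via $u(k)=(u(v_1,k),\dots,u(v_n,k))$. It is an infinitesimal (first-order) flex if $(u(x)-u(y))\cdot(p(x)-p(y))=0$ for every edge $xy\in E$ (bilinear dot product); these form $\mathcal{F}(\mathcal{C};\mathbb{C})$. $\mathcal{F}_{\rm rig}(\mathcal{C};\mathbb{C})$ is the complex linear span of the rigid-motion flexes $x\mapsto Sp(x)+b$ ($S$ a real skew-symmetric $d\times d$ matrix, $b\in\mathbb{R}^d$). For $\omega\in\mathbb{C}_*^d=(\mathbb{C}\setminus\{0\})^d$, $k\in\mathbb{Z}^d$, write $\omega^k=\omega_1^{k_1}\cdots\omega_d^{k_d}$.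 $\mathcal{V}_{\rm exp}(\mathcal{C};\mathbb{C})$ is the linear span of all fields $k\mapsto q(k)\omega^k a$ with $\omega\in\mathbb{C}_*^d$, $q\in\mathbb{C}[z_1,\dots,z_d]$, $a\in\mathbb{C}^{dn}$; $\mathcal{F}_{\rm exp}=\mathcal{V}_{\rm exp}\cap\mathcal{F}$. A factor-periodic flex with multi-factor $\omega\in\mathbb{C}_*^d$ is a flex with $u(k)=\omega^k u(0)$ for all $k$. A flexible lattice periodic flex is a flex of the form $u(k)=u(0)+(Xk,\dots,Xk)$ for some $X\in M_d(\mathbb{C})$. $\mathbb{C}(z)$ denotes the Laurent polynomial ring in $z_1,\dots,z_d$. The transfer function $\Psi_{\mathcal{C}}(z)$ is the $m\times dn$ matrix over $\mathbb{C}(z)$ with rows indexed by motif edges and columns grouped in $n$ blocks of $d$ indexed by $F_v$: for $e=(v,k)(w,l)$ with $v\neq w$ the row has $p(e)z^{-k}$ in block $v$, $-p(e)z^{-l}$ in block $w$ and zeros elsewhere; if $v=w$ it has $p(e)(z^{-k}-z^{-l})$ in block $v$ and zeros elsewhere. $M(\mathcal{C})$ is the $\mathbb{C}(z)$-submodule of $\mathbb{C}(z)\otimes\mathbb{C}^{dn}$ generated by the rows of $\Psi_{\mathcal{C}}$. The matrix $R_{\rm fper}(\mathcal{C})$ is the $m\times(dn+d^2)$ scalar matrix whose row for $e=(v,k)(w,l)$ with $v\ne w$ has $p(e)$ in block $v$, $-p(e)$ in block $w$, zeros in the other vertex blocks, followed by the $d$ blocks $(l_1-k_1)p(e),\dots,(l_d-k_d)p(e)$;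 if $v=w$ the vertex blocks are zero and the last $d$ blocks are $(l_1-k_1)p(e),\dots,(l_d-k_d)p(e)$. For $P=\sum_k a_kz^k\in\mathbb{C}(z)\otimes\mathbb{C}^{dn}$ ($a_k\in\mathbb{C}^{dn}$, finitely many nonzero) and $u\in C(\mathbb{Z}^d;\mathbb{C}^{dn})$ set $\langle P,u\rangle=\sum_k a_k\cdot u(-k)$. The rigidity module is $M_{\rm rig}(\mathcal{C})=\{P\in\mathbb{C}(z)\otimes\mathbb{C}^{dn}:\langle P,u\rangle=0\ \text{for all } u\in\mathcal{F}_{\rm rig}(\mathcal{C};\mathbb{C})\}$. *)

theory Defs
  imports "HOL-Analysis.Analysis"
begin

(* A crystal framework is encoded through its motif data relative to a fixed
   periodic structure:
     'd  : index type of the coordinates (d = CARD('d)),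
     'v  : the motif vertices F_v        (n = CARD('v)),
     'e  : the motif edges F_e           (m = CARD('e)),
     p0 v : position of the motif vertex v = (v,0),
     a i  : the periodic structure vectors a_1..a_d,
     edg e = ((v,k),(w,l)) : the motif edge e = (v,k)(w,l).
   The vertex set is F_v x Z^d, (v,k) = k.v, and the edge set is the set of
   all translates {(v,k+t),(w,l+t)} of the motif edges. *)

type_synonym ('v,'d) medge = "('v \<times> (int^'d)) \<times> ('v \<times> (int^'d))"

(* complex velocity fields u : V -> C^d, written u v k j = j-th coordinate of u(v,k) *)
type_synonym ('v,'d) vfield = "'v \<Rightarrow> int^'d \<Rightarrow> 'd \<Rightarrow> complex"

(* elements of C(z) (x) C^{dn}: finitely supported coefficient maps k |-> a_k *)
type_synonym ('v,'d) lvec = "int^'d \<Rightarrow> 'v \<Rightarrow> 'd \<Rightarrow> complex"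

definition pos :: "('v \<Rightarrow> real^'d) \<Rightarrow> ('d::finite \<Rightarrow> real^'d) \<Rightarrow> 'v \<Rightarrow> int^'d \<Rightarrow> real^'d" where
  "pos p0 a v k = p0 v + (\<Sum>i\<in>UNIV. of_int (k$i) *\<^sub>R a i)"

definition shiftv :: "int^'d \<Rightarrow> ('v \<times> (int^'d)) \<Rightarrow> ('v \<times> (int^'d))" where
  "shiftv t x = (fst x, snd x + t)"

definition pedge :: "('v \<Rightarrow> real^'d) \<Rightarrow> ('d::finite \<Rightarrow> real^'d) \<Rightarrow> ('v,'d) medge \<Rightarrow> real^'d" where
  "pedge p0 a x = (case x of ((v,k),(w,l)) \<Rightarrow> pos p0 a v k - pos p0 a w l)"

definition crystal_framework ::
  "('v::finite \<Rightarrow> real^'d) \<Rightarrow> ('d::finite \<Rightarrow> real^'d) \<Rightarrow> ('e::finite \<Rightarrow> ('v,'d) medge) \<Rightarrow> bool" where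
  "crystal_framework p0 a edg \<longleftrightarrow>
     inj a \<and> independent (range a) \<and>
     inj (\<lambda>(v,k). pos p0 a v k) \<and>
     (\<forall>e. fst (edg e) \<noteq> snd (edg e)) \<and>
     (\<forall>e e' t. e \<noteq> e' \<longrightarrow>
        {shiftv t (fst (edg e')), shiftv t (snd (edg e'))} \<noteq> {fst (edg e), snd (edg e)})"

definition is_flex ::
  "('v::finite \<Rightarrow> real^'d) \<Rightarrow> ('d::finite \<Rightarrow> real^'d) \<Rightarrow> ('e \<Rightarrow> ('v,'d) medge) \<Rightarrow> ('v,'d) vfield \<Rightarrow> bool" where
  "is_flex p0 a edg u \<longleftrightarrow>
     (\<forall>e v k w l t. edg e = ((v,k),(w,l)) \<longrightarrow>
        (\<Sum>j\<in>UNIV. (u v (k+t) j - u w (l+t) j)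
              * complex_of_real ((pos p0 a v (k+t) - pos p0 a w (l+t)) $ j)) = 0)"

definition flexes where
  "flexes p0 a edg = {u. is_flex p0 a edg u}"

definition cspan :: "('v,'d::finite) vfield set \<Rightarrow> ('v,'d) vfield set" where
  "cspan G = {u. \<exists>(N::nat) c r. (\<forall>i<N. r i \<in> G) \<and>
                    u = (\<lambda>v k j. \<Sum>i<N. (c i :: complex) * r i v k j)}"

definition rigid_motion ::
  "('v \<Rightarrow> real^'d) \<Rightarrow> ('d::finite \<Rightarrow> real^'d) \<Rightarrow> real^'d^'d \<Rightarrow> real^'d \<Rightarrow> ('v,'d) vfield" where
  "rigid_motion p0 a S b = (\<lambda>v k j. complex_of_real ((S *v pos p0 a v k + b) $ j))"

definition flexes_rig where
  "flexes_rig p0 a = cspan {rigid_motion p0 a S b | S b. transpose S = - S}"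

definition mpow :: "complex^'d \<Rightarrow> int^'d \<Rightarrow> complex" where
  "mpow w k = (\<Prod>i\<in>UNIV. (w$i) powi (k$i))"

definition is_poly_fun :: "(int^'d \<Rightarrow> complex) \<Rightarrow> bool" where
  "is_poly_fun q \<longleftrightarrow> (\<exists>A c. finite (A :: (nat^'d) set) \<and>
      (\<forall>k. q k = (\<Sum>\<alpha>\<in>A. c \<alpha> * (\<Prod>i\<in>UNIV. (of_int (k$i) :: complex) ^ (\<alpha>$i)))))"

definition V_exp :: "('v,'d::finite) vfield set" where
  "V_exp = cspan {(\<lambda>v k j. q k * mpow w k * A v j) | q w A.
                      is_poly_fun q \<and> (\<forall>i. w$i \<noteq> 0)}"

definition flexes_exp where
  "flexes_exp p0 a edg = V_exp \<inter> flexes p0 a edg"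

definition factor_periodic_flex where
  "factor_periodic_flex p0 a edg w u \<longleftrightarrow>
     is_flex p0 a edg u \<and> (\<forall>v k j. u v k j = mpow w k * u v 0 j)"

definition flexible_lattice_periodic_flex where
  "flexible_lattice_periodic_flex p0 a edg u \<longleftrightarrow>
     is_flex p0 a edg u \<and>
     (\<exists>X :: complex^'d^'d. \<forall>v k j. u v k j = u v 0 j + (\<Sum>i\<in>UNIV. X$j$i * of_int (k$i)))"

definition transfer ::
  "('v::finite \<Rightarrow> real^'d) \<Rightarrow> ('d::finite \<Rightarrow> real^'d) \<Rightarrow> ('e::finite \<Rightarrow> ('v,'d) medge)
     \<Rightarrow> complex^'d \<Rightarrow> complex^('v \<times> 'd)^'e" where
  "transfer p0 a edg z = (\<chi> e. \<chi> c.
     (case edg e of ((v,k),(w,l)) \<Rightarrow>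
       (if fst c = v then complex_of_real (pedge p0 a (edg e) $ snd c) * mpow z (-k) else 0)
     - (if fst c = w then complex_of_real (pedge p0 a (edg e) $ snd c) * mpow z (-l) else 0)))"

definition R_fper ::
  "('v::finite \<Rightarrow> real^'d) \<Rightarrow> ('d::finite \<Rightarrow> real^'d) \<Rightarrow> ('e::finite \<Rightarrow> ('v,'d) medge)
     \<Rightarrow> real^(('v \<times> 'd) + ('d \<times> 'd))^'e" where
  "R_fper p0 a edg = (\<chi> e. \<chi> c.
     (case edg e of ((v,k),(w,l)) \<Rightarrow>
       (case c of
          Inl (x,j) \<Rightarrow> (if x = v then pedge p0 a (edg e) $ j else 0)
                     - (if x = w then pedge p0 a (edg e) $ j else 0)
        | Inr (i,j) \<Rightarrow> of_int (l$i - k$i) * pedge p0 a (edg e) $ j)))"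

(* Laurent polynomial (vectors): finitely supported coefficient families *)
definition lfin :: "(int^'d \<Rightarrow> 'b::zero) \<Rightarrow> bool" where
  "lfin f \<longleftrightarrow> finite {k. f k \<noteq> 0}"

definition lsupp :: "('v,'d) lvec \<Rightarrow> (int^'d) set" where
  "lsupp P = {k. \<exists>x j. P k x j \<noteq> 0}"

definition lmult :: "(int^'d \<Rightarrow> complex) \<Rightarrow> ('v,'d) lvec \<Rightarrow> ('v,'d) lvec" where
  "lmult f P = (\<lambda>t x j. \<Sum>s\<in>{s. f s \<noteq> 0}. f s * P (t - s) x j)"

(* the row of Psi_C for the motif edge e, as a Laurent vector *)
definition lrow :: "('v \<Rightarrow> real^'d) \<Rightarrow> ('d::finite \<Rightarrow> real^'d) \<Rightarrow> ('v,'d) medge \<Rightarrow> ('v,'d) lvec" where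
  "lrow p0 a x = (case x of ((v,k),(w,l)) \<Rightarrow>
     (\<lambda>t y j. (if t = -k \<and> y = v then complex_of_real (pedge p0 a x $ j) else 0)
            - (if t = -l \<and> y = w then complex_of_real (pedge p0 a x $ j) else 0)))"

definition module_C ::
  "('v::finite \<Rightarrow> real^'d) \<Rightarrow> ('d::finite \<Rightarrow> real^'d) \<Rightarrow> ('e::finite \<Rightarrow> ('v,'d) medge) \<Rightarrow> ('v,'d) lvec set" where
  "module_C p0 a edg = {P. \<exists>f. (\<forall>e. lfin (f e)) \<and>
       P = (\<lambda>t x j. \<Sum>e\<in>UNIV. lmult (f e) (lrow p0 a (edg e)) t x j)}"

definition lpair :: "('v::finite,'d::finite) lvec \<Rightarrow> ('v,'d) vfield \<Rightarrow> complex" where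
  "lpair P u = (\<Sum>k\<in>lsupp P. \<Sum>x\<in>UNIV. \<Sum>j\<in>UNIV. P k x j * u x (-k) j)"

definition module_rig ::
  "('v::finite \<Rightarrow> real^'d) \<Rightarrow> ('d::finite \<Rightarrow> real^'d) \<Rightarrow> ('v,'d) lvec set" where
  "module_rig p0 a = {P. finite (lsupp P) \<and> (\<forall>u\<in>flexes_rig p0 a. lpair P u = 0)}"

end

theory Submission
  imports Defs "HOL-Library.Poly_Mapping" "HOL-Computational_Algebra.Fundamental_Theorem_Algebra"
begin

text \<open>
  The velocity fields form the algebraic dual of the space of Laurent vectors, and the flexes are
  the annihilator of the module \<open>M(C)\<close> generated by the rows of the transfer function. Taking
  annihilators twice gives (i) \<open>\<longleftrightarrow>\<close> (v); (iii) \<open>\<longleftrightarrow>\<close> (iv) is rank plus nullity.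

  For (iii) \<open>\<Longrightarrow>\<close> (i), let \<open>D\<^sub>i\<close> be the difference operator in the \<open>i\<close>-th lattice direction. If
  \<open>D\<^sub>i D\<^sub>j u \<noteq> 0\<close> for some flex \<open>u\<close>, then the images of the Laurent vectors under second differences
  generate a nonzero finitely generated module modulo \<open>M(C)\<close>. By Nakayama's lemma and the
  Nullstellensatz it has a one-dimensional quotient, which dually is a flex whose second differences
  are factor-periodic with one common multi-factor \<open>\<omega>\<close> and do not all vanish. The case \<open>\<omega> \<noteq> 1\<close> is
  impossible because a rigid motion field is affine. If \<open>\<omega> = 1\<close> the third differences vanish, so
  the first differences are rigid, \<open>D\<^sub>i u = S\<^sub>i p + b\<^sub>i\<close>, and commutation of differences gives
  \<open>S\<^sub>i a\<^sub>j = S\<^sub>j a\<^sub>i\<close>; then \<open>a\<^sub>n \<cdot> S\<^sub>i a\<^sub>j\<close> is symmetric in \<open>i, j\<close> and skew in \<open>j, n\<close>, hence zero. So all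
  second differences of flexes vanish, and such flexes are flexible lattice periodic.
\<close>

section \<open>A weak Nullstellensatz\<close>

lemma poly_mapping_sum_single: "f = (\<Sum>k\<in>Poly_Mapping.keys f. Poly_Mapping.single k (Poly_Mapping.lookup f k))"
  by (rule poly_mapping_eqI) (simp add: lookup_sum lookup_single when_def in_keys_iff)

definition ring_ideal :: "'r::comm_ring_1 set \<Rightarrow> bool" where
  "ring_ideal I \<longleftrightarrow> 0 \<in> I \<and> (\<forall>x\<in>I. \<forall>y\<in>I. x + y \<in> I) \<and> (\<forall>r. \<forall>x\<in>I. r * x \<in> I)"

lemma ring_idealD:
  assumes "ring_ideal I"
  shows ring_ideal_0: "0 \<in> I"
    and ring_ideal_add: "x \<in> I \<Longrightarrow> y \<in> I \<Longrightarrow> x + y \<in> I"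
    and ring_ideal_mult: "x \<in> I \<Longrightarrow> r * x \<in> I"
    and ring_ideal_uminus: "x \<in> I \<Longrightarrow> - x \<in> I"
    and ring_ideal_diff: "x \<in> I \<Longrightarrow> y \<in> I \<Longrightarrow> x - y \<in> I"
proof -
  show 1: "0 \<in> I" "x \<in> I \<Longrightarrow> y \<in> I \<Longrightarrow> x + y \<in> I" "x \<in> I \<Longrightarrow> r * x \<in> I" for x y r
    using assms by (auto simp: ring_ideal_def)
  show 2: "x \<in> I \<Longrightarrow> - x \<in> I" for x
    using 1(3)[of x "-1"] by simp
  show "x \<in> I \<Longrightarrow> y \<in> I \<Longrightarrow> x - y \<in> I"
    using 1(2)[of x "-y"] 2 by simp
qed

lemma ring_ideal_sum:
  assumes "ring_ideal I" "\<And>i. i \<in> A \<Longrightarrow> f i \<in> I"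
  shows "sum f A \<in> I"
  using assms(2)
  by (induction A rule: infinite_finite_induct) (auto intro: ring_idealD[OF assms(1)])

section \<open>Complex polynomials evaluated at an element of a monoid algebra\<close>

definition poly_at :: "('k::comm_monoid_add \<Rightarrow>\<^sub>0 complex) \<Rightarrow> complex poly \<Rightarrow> ('k \<Rightarrow>\<^sub>0 complex)" where
  "poly_at T q = poly (map_poly (Poly_Mapping.single 0) q) T"

lemma poly_at_0 [simp]: "poly_at T 0 = 0"
  by (simp add: poly_at_def)

lemma poly_at_pCons [simp]: "poly_at T (pCons c q) = Poly_Mapping.single 0 c + T * poly_at T q"
  by (simp add: poly_at_def map_poly_pCons)

lemma poly_at_add: "poly_at T (p + q) = poly_at T p + poly_at T q"
  by (induction p q rule: poly_induct2) (simp_all add: single_add algebra_simps)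

lemma poly_at_smult: "poly_at T (smult c q) = Poly_Mapping.single 0 c * poly_at T q"
  by (induction q) (simp_all add: mult_single algebra_simps)

lemma poly_at_mult: "poly_at T (p * q) = poly_at T p * poly_at T q"
  by (induction p) (simp_all add: poly_at_add poly_at_smult algebra_simps)

lemma poly_at_sum: "poly_at T (sum f A) = (\<Sum>i\<in>A. poly_at T (f i))"
  by (induction A rule: infinite_finite_induct) (simp_all add: poly_at_add)

lemma poly_at_1 [simp]: "poly_at T 1 = 1"
  unfolding one_pCons by (simp del: One_nat_def)

lemma poly_at_prod: "poly_at T (prod f A) = (\<Prod>i\<in>A. poly_at T (f i))"
  by (induction A rule: infinite_finite_induct) (simp_all add: poly_at_mult)

lemma poly_at_linear: "poly_at T [:- c, 1:] = T - Poly_Mapping.single 0 c"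
  by (simp add: single_uminus)

text \<open>Over the complex numbers \<open>q\<close> splits into linear factors. Each factor
  \<open>T - c\<close> is invertible modulo \<open>I\<close>, so the factors can be cancelled one at
  a time until a nonzero constant is left in \<open>I\<close>.\<close>

lemma one_in_ideal_if_poly_at:
  fixes I :: "('k::comm_monoid_add \<Rightarrow>\<^sub>0 complex) set"
  assumes I: "ring_ideal I"
    and inv: "\<And>c. \<exists>f. f * (T - Poly_Mapping.single 0 c) - 1 \<in> I"
    and "q \<noteq> 0" "poly_at T q \<in> I"
  shows "1 \<in> I"
  using assms(3,4)
proof (induction "degree q" arbitrary: q)
  case 0
  then obtain c where q: "q = [:c:]" "c \<noteq> 0"
    by (metis degree_eq_zeroE pCons_0_0)
  have "Poly_Mapping.single 0 (inverse c) * Poly_Mapping.single 0 c \<in> I"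
    using 0 q by (intro ring_ideal_mult[OF I]) auto
  with q show ?case
    by (simp add: mult_single)
next
  case (Suc n)
  obtain z where "poly q z = 0"
    using fundamental_theorem_of_algebra[of q] Suc(2) by (metis constant_degree nat.distinct(1))
  then obtain r where r: "q = [:- z, 1:] * r"
    by (metis dvdE poly_eq_0_iff_dvd)
  with Suc.prems have "r \<noteq> 0" by auto
  have "degree q = 1 + degree r"
    unfolding r using \<open>r \<noteq> 0\<close> by (subst degree_mult_eq) auto
  obtain f where f: "f * (T - Poly_Mapping.single 0 z) - 1 \<in> I"
    using inv by blast
  \<comment> \<open>With \<open>q = (X - z) r\<close>, multiplying by the inverse \<open>f\<close>
    of \<open>T - z\<close> modulo \<open>I\<close> and correcting by an ideal element leaves
    exactly \<open>r\<close> evaluated at \<open>T\<close>.\<close>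
  have "f * poly_at T q - poly_at T r * (f * (T - Poly_Mapping.single 0 z) - 1) \<in> I"
    by (rule ring_ideal_diff[OF I ring_ideal_mult[OF I Suc.prems(2)] ring_ideal_mult[OF I f]])
  moreover have "f * poly_at T q - poly_at T r * (f * (T - Poly_Mapping.single 0 z) - 1) = poly_at T r"
    unfolding r poly_at_mult poly_at_linear by (simp add: algebra_simps)
  ultimately show ?case
    using Suc.hyps \<open>r \<noteq> 0\<close> \<open>degree q = 1 + degree r\<close> by auto
qed

interpretation pm: vector_space "\<lambda>c f. Poly_Mapping.single 0 c * (f :: 'k::comm_monoid_add \<Rightarrow>\<^sub>0 complex)"
  by unfold_locales (simp_all add: algebra_simps single_add mult_single)

text \<open>Over the uncountable field \<open>\<complex>\<close> an algebra of countable dimension has no room for the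
  resolvents \<open>(T - c)\<inverse>\<close> of all \<open>c\<close>: a linear relation between them turns into a polynomial
  equation for \<open>T\<close>.\<close>

lemma exists_spectral_value:
  fixes I :: "('k::{comm_monoid_add,countable} \<Rightarrow>\<^sub>0 complex) set"
  assumes I: "ring_ideal I" and "1 \<notin> I"
  shows "\<exists>c. \<forall>f. f * (T - Poly_Mapping.single 0 c) - 1 \<notin> I"
proof (rule ccontr)
  assume "\<not> ?thesis"
  then have inv: "\<exists>f. f * (T - Poly_Mapping.single 0 c) - 1 \<in> I" for c
    by blast
  then obtain F where F: "\<And>c. F c * (T - Poly_Mapping.single 0 c) - 1 \<in> I"
    by metis
  \<comment> \<open>If \<open>F c = F d\<close> with \<open>c\<close> different from
    \<open>d\<close>, subtracting the two resolvent equations puts \<open>(d - c) F c\<close>, hence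
    \<open>F c\<close>, and finally 1 into \<open>I\<close>.\<close>
  have inj: "inj F"
  proof (rule injI, rule ccontr)
    fix c d assume *: "F c = F d" "c \<noteq> d"
    have "(F c * (T - Poly_Mapping.single 0 c) - 1) - (F d * (T - Poly_Mapping.single 0 d) - 1) \<in> I"
      by (intro ring_ideal_diff[OF I] F)
    also have "(F c * (T - Poly_Mapping.single 0 c) - 1) - (F d * (T - Poly_Mapping.single 0 d) - 1)
        = Poly_Mapping.single 0 (d - c) * F c"
      using * by (simp add: algebra_simps single_diff)
    finally have "Poly_Mapping.single 0 (inverse (d - c)) * (Poly_Mapping.single 0 (d - c) * F c) \<in> I"
      by (rule ring_ideal_mult[OF I])
    moreover have "Poly_Mapping.single 0 (inverse (d - c)) * (Poly_Mapping.single 0 (d - c) * F c) = F c"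
      using * by (simp add: mult.assoc[symmetric] mult_single)
    ultimately have "F c \<in> I" by simp
    then have "(T - Poly_Mapping.single 0 c) * F c - (F c * (T - Poly_Mapping.single 0 c) - 1) \<in> I"
      by (intro ring_ideal_diff[OF I] ring_ideal_mult[OF I] F)
    then show False using \<open>1 \<notin> I\<close> by (simp add: algebra_simps)
  qed
  \<comment> \<open>The exponents are countable, so there are only countably many finite supports
    for uncountably many \<open>c\<close>. Some support is shared by infinitely many
    resolvents.\<close>
  obtain S where S: "finite S" "infinite {c. Poly_Mapping.keys (F c) = S}"
  proof -
    have "\<exists>S\<in>{S. finite S}. infinite {c. Poly_Mapping.keys (F c) = S}"
    proof (rule ccontr)
      assume "\<not> ?thesis"
      then have "countable (\<Union>S\<in>{S. finite S}. {c. Poly_Mapping.keys (F c) = S})"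
        by (intro countable_UN) (auto intro: countable_finite countable_Collect_finite)
      moreover have "(\<Union>S\<in>{S. finite S}. {c. Poly_Mapping.keys (F c) = S}) = UNIV"
        by auto
      ultimately show False
        using uncountable_UNIV_complex by simp
    qed
    then show ?thesis using that by auto
  qed
  define L where "L = {c. Poly_Mapping.keys (F c) = S}"
  have "infinite (F ` L)"
    using S(2) inj by (metis L_def finite_imageD inj_on_subset subset_UNIV)
  moreover have "F ` L \<subseteq> pm.span ((\<lambda>k. Poly_Mapping.single k 1) ` S)"
  proof clarify
    fix c assume "c \<in> L"
    then have "F c = (\<Sum>k\<in>S. Poly_Mapping.single 0 (Poly_Mapping.lookup (F c) k) * Poly_Mapping.single k 1)"
      by (subst poly_mapping_sum_single) (simp add: L_def mult_single)
    also have "\<dots> \<in> pm.span ((\<lambda>k. Poly_Mapping.single k 1) ` S)"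
      by (intro pm.span_sum pm.span_scale pm.span_base) auto
    finally show "F c \<in> \<dots>" .
  qed
  \<comment> \<open>Infinitely many distinct elements lie in the span of the finitely many monomials
    with exponent in \<open>S\<close>.\<close>
  ultimately have "pm.dependent (F ` L)"
    using pm.independent_span_bound S(1) by (metis finite_imageI)
  then obtain t u where t: "finite t" "t \<subseteq> F ` L" "(\<Sum>v\<in>t. Poly_Mapping.single 0 (u v) * v) = 0"
      "\<exists>v\<in>t. u v \<noteq> 0"
    unfolding pm.dependent_explicit by blast
  then obtain A where A: "A \<subseteq> L" "finite A" "t = F ` A"
    using finite_subset_image[OF t(1,2)] by blast
  define c where "c = u \<circ> F"
  have sum0: "(\<Sum>a\<in>A. Poly_Mapping.single 0 (c a) * F a) = 0"
    using t(3) A inj by (simp add: sum.reindex inj_on_subset c_def)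
  obtain b where b: "b \<in> A" "c b \<noteq> 0"
    using t(4) A by (auto simp: c_def)
  \<comment> \<open>The numerator obtained when the sum of the fractions
    \<open>c a / (X - a)\<close> is brought to a common denominator. At the root \<open>b\<close>
    only the summand with \<open>a = b\<close> survives, so \<open>q\<close> is nonzero.\<close>
  define q where "q = (\<Sum>a\<in>A. smult (c a) (\<Prod>m\<in>A - {a}. [:- m, 1:]))"
  have "poly q b = (\<Sum>a\<in>A. if a = b then c b * (\<Prod>m\<in>A - {b}. b - m) else 0)"
    unfolding q_def poly_sum poly_smult poly_prod
    using A(2) b(1) by (intro sum.cong) (auto simp: prod_zero_iff)
  also have "\<dots> \<noteq> 0"
    using A(2) b by simp
  finally have "q \<noteq> 0" by auto
  define P where "P = (\<Prod>m\<in>A. T - Poly_Mapping.single 0 m)"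
  \<comment> \<open>Clearing denominators: modulo \<open>I\<close>, multiplying \<open>F a\<close>
    by \<open>P\<close> cancels the factor \<open>T - a\<close>. The linear relation times
    \<open>P\<close> thus becomes the statement that \<open>q\<close> at \<open>T\<close> lies in
    \<open>I\<close>.\<close>
  have "(\<Sum>a\<in>A. Poly_Mapping.single 0 (c a) * (F a * P - (\<Prod>m\<in>A - {a}. T - Poly_Mapping.single 0 m))) \<in> I"
  proof (intro ring_ideal_sum[OF I] ring_ideal_mult[OF I])
    fix a assume "a \<in> A"
    then have "F a * P - (\<Prod>m\<in>A - {a}. T - Poly_Mapping.single 0 m)
       = (\<Prod>m\<in>A - {a}. T - Poly_Mapping.single 0 m) * (F a * (T - Poly_Mapping.single 0 a) - 1)"
      unfolding P_def using A(2) by (simp add: prod.remove[of A a] algebra_simps)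
    also have "\<dots> \<in> I"
      by (intro ring_ideal_mult[OF I] F)
    finally show "F a * P - (\<Prod>m\<in>A - {a}. T - Poly_Mapping.single 0 m) \<in> I" .
  qed
  also have "(\<Sum>a\<in>A. Poly_Mapping.single 0 (c a) * (F a * P - (\<Prod>m\<in>A - {a}. T - Poly_Mapping.single 0 m)))
      = (\<Sum>a\<in>A. Poly_Mapping.single 0 (c a) * F a) * P - poly_at T q"
    unfolding q_def poly_at_sum poly_at_smult poly_at_prod poly_at_linear sum_distrib_right
    by (simp add: sum_subtractf[symmetric] right_diff_distrib mult.assoc del: poly_at_pCons)
  finally have "poly_at T q \<in> I"
    using ring_ideal_uminus[OF I] unfolding sum0 by fastforce
  then show False
    using one_in_ideal_if_poly_at[OF I inv \<open>q \<noteq> 0\<close>] \<open>1 \<notin> I\<close> by blast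
qed

text \<open>The elements \<open>T i - w i\<close> are adjoined one after another. Each time
  \<open>w i\<close> is a spectral value of \<open>T i\<close> modulo the ideal reached so far,
  which is what keeps the enlarged ideal proper.\<close>

lemma weak_nullstellensatz:
  fixes I :: "('k::{comm_monoid_add,countable} \<Rightarrow>\<^sub>0 complex) set"
  assumes "finite A" and I: "ring_ideal I" and "1 \<notin> I"
  shows "\<exists>J w. ring_ideal J \<and> I \<subseteq> J \<and> 1 \<notin> J \<and> (\<forall>i\<in>A. T i - Poly_Mapping.single 0 (w i) \<in> J)"
  using assms(1)
proof (induction A)
  case empty
  then show ?case using assms by blast
next
  case (insert i A)
  then obtain J w where J: "ring_ideal J" "I \<subseteq> J" "1 \<notin> J" "\<forall>i\<in>A. T i - Poly_Mapping.single 0 (w i) \<in> J"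
    by blast
  obtain c where c: "\<And>f. f * (T i - Poly_Mapping.single 0 c) - 1 \<notin> J"
    using exists_spectral_value[OF J(1,3)] by blast
  \<comment> \<open>The ideal generated by \<open>J\<close> and \<open>T i - c\<close>. If it
    contained 1, then \<open>T i - c\<close> would be invertible modulo \<open>J\<close>, against
    the choice of \<open>c\<close>.\<close>
  define K where "K = {f * (T i - Poly_Mapping.single 0 c) + x |f x. x \<in> J}"
  have "ring_ideal K"
    unfolding ring_ideal_def
  proof (intro conjI ballI allI)
    show "0 \<in> K"
      unfolding K_def using ring_ideal_0[OF J(1)] by (auto intro!: exI[of _ 0])
    show "x + y \<in> K" if xy: "x \<in> K" "y \<in> K" for x y
    proof -
      obtain f g x' y' where "x = f * (T i - Poly_Mapping.single 0 c) + x'" "x' \<in> J"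
          "y = g * (T i - Poly_Mapping.single 0 c) + y'" "y' \<in> J"
        using xy by (auto simp: K_def)
      then have "x + y = (f + g) * (T i - Poly_Mapping.single 0 c) + (x' + y')" "x' + y' \<in> J"
        using ring_ideal_add[OF J(1)] by (simp_all add: distrib_right)
      then show ?thesis unfolding K_def by blast
    qed
    show "r * x \<in> K" if x: "x \<in> K" for r x
    proof -
      obtain f x' where "x = f * (T i - Poly_Mapping.single 0 c) + x'" "x' \<in> J"
        using x by (auto simp: K_def)
      then have "r * x = (r * f) * (T i - Poly_Mapping.single 0 c) + r * x'" "r * x' \<in> J"
        using ring_ideal_mult[OF J(1)] by (simp_all add: distrib_left mult.assoc)
      then show ?thesis unfolding K_def by blast
    qed
  qed
  moreover have sub: "J \<subseteq> K"
    unfolding K_def by (force intro: exI[of _ 0])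
  moreover have "1 \<notin> K"
  proof
    assume "1 \<in> K"
    then obtain f x where "1 = f * (T i - Poly_Mapping.single 0 c) + x" "x \<in> J"
      by (auto simp: K_def)
    then have "f * (T i - Poly_Mapping.single 0 c) - 1 = - x" "- x \<in> J"
      using ring_ideal_uminus[OF J(1)] by (simp_all add: eq_diff_eq diff_eq_eq)
    then show False using c by metis
  qed
  moreover have "T i - Poly_Mapping.single 0 c \<in> K"
    unfolding K_def using ring_ideal_0[OF J(1)] by (intro CollectI exI[of _ 1] exI[of _ 0]) simp
  ultimately show ?case
    using J insert(2) by (intro exI[of _ K] exI[of _ "w(i := c)"]) auto
qed

text \<open>Nakayama's lemma, in the form: a finitely generated module that is not contained in \<open>M\<close> has a
  one-dimensional quotient modulo \<open>M\<close>. Enlarging \<open>M\<close> by as many generators as possible reduces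
  to the cyclic case.\<close>

lemma exists_eigenvalue_quotient:
  fixes sc :: "('k::{comm_monoid_add,countable} \<Rightarrow>\<^sub>0 complex) \<Rightarrow> 'w::ab_group_add \<Rightarrow> 'w"
  assumes m: "module sc" and M: "module.subspace sc M"
    and G: "finite G" "\<not> G \<subseteq> M" and A: "finite A"
  shows "\<exists>U w. module.subspace sc U \<and> M \<subseteq> U \<and> \<not> G \<subseteq> U \<and>
           (\<forall>i\<in>A. \<forall>g\<in>G. sc (T i - Poly_Mapping.single 0 (w i)) g \<in> U)"
proof -
  interpret module sc by (rule m)
  \<comment> \<open>Sets of generators that, together with \<open>M\<close>, still fail to generate
    \<open>G\<close>. For a maximal such \<open>H\<close> and any \<open>g\<close> in
    \<open>G\<close> outside the resulting \<open>N\<close>, everything in \<open>G\<close> is a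
    multiple of \<open>g\<close> modulo \<open>N\<close>.\<close>
  define \<H> where "\<H> = {H. H \<subseteq> G \<and> \<not> G \<subseteq> span (M \<union> H)}"
  have "finite \<H>"
    using G by (simp add: \<H>_def)
  moreover have "{} \<in> \<H>"
    unfolding \<H>_def using G span_minimal[OF subset_refl M] by auto
  ultimately obtain H where H: "H \<in> \<H>" "\<And>H'. H' \<in> \<H> \<Longrightarrow> H \<subseteq> H' \<Longrightarrow> H = H'"
    using finite_has_maximal[of \<H>] by (metis empty_iff)
  define N where "N = span (M \<union> H)"
  obtain g where g: "g \<in> G" "g \<notin> N"
    using H(1) by (auto simp: \<H>_def N_def)
  have "g \<notin> H"
    using g by (auto simp: N_def intro: span_base)
  then have "insert g H \<notin> \<H>"
    using H(2) by blast
  then have Gsub: "G \<subseteq> span (insert g (M \<union> H))"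
    using H(1) g by (auto simp: \<H>_def)
  have N: "subspace N"
    by (simp add: N_def)
  \<comment> \<open>The annihilator of the class of \<open>g\<close> modulo \<open>N\<close>; it is
    proper because \<open>g\<close> is not in \<open>N\<close>.\<close>
  define I where "I = {f. sc f g \<in> N}"
  have I: "ring_ideal I"
    unfolding ring_ideal_def I_def
    using subspace_add[OF N] subspace_scale[OF N] subspace_0[OF N]
    by (auto simp: scale_left_distrib simp flip: scale_scale)
  have "1 \<notin> I"
    using g by (simp add: I_def)
  obtain J w where J: "ring_ideal J" "I \<subseteq> J" "1 \<notin> J"
      "\<forall>i\<in>A. T i - Poly_Mapping.single 0 (w i) \<in> J"
    using weak_nullstellensatz[OF A I \<open>1 \<notin> I\<close>] by blast
  \<comment> \<open>This is \<open>N + J g\<close>. If it contained \<open>g\<close>, some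
    \<open>f\<close> in \<open>J\<close> would have \<open>1 - f\<close> in the annihilator
    \<open>I\<close>, a subset of \<open>J\<close>, and then 1 would lie in
    \<open>J\<close>.\<close>
  define U where "U = {x. \<exists>f\<in>J. x - sc f g \<in> N}"
  have U: "subspace U"
  proof (rule subspaceI)
    show "0 \<in> U"
      unfolding U_def using ring_ideal_0[OF J(1)] subspace_0[OF N] by (auto intro!: bexI[of _ 0])
    show "x + y \<in> U" if "x \<in> U" "y \<in> U" for x y
    proof -
      obtain f h where "f \<in> J" "h \<in> J" "x - sc f g \<in> N" "y - sc h g \<in> N"
        using \<open>x \<in> U\<close> \<open>y \<in> U\<close> by (auto simp: U_def)
      then have "f + h \<in> J" "(x + y) - sc (f + h) g \<in> N"
        using ring_ideal_add[OF J(1)] subspace_add[OF N, of "x - sc f g" "y - sc h g"]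
        by (auto simp: scale_left_distrib algebra_simps)
      then show ?thesis by (auto simp: U_def)
    qed
    show "sc r x \<in> U" if "x \<in> U" for r x
    proof -
      obtain f where "f \<in> J" "x - sc f g \<in> N"
        using \<open>x \<in> U\<close> by (auto simp: U_def)
      then have "r * f \<in> J" "sc r x - sc (r * f) g \<in> N"
        using ring_ideal_mult[OF J(1)] subspace_scale[OF N, of "x - sc f g" r]
        by (auto simp: scale_right_diff_distrib)
      then show ?thesis by (auto simp: U_def)
    qed
  qed
  have NU: "N \<subseteq> U"
    unfolding U_def using ring_ideal_0[OF J(1)] by (auto intro!: bexI[of _ 0])
  have gU: "g \<notin> U"
  proof
    assume "g \<in> U"
    then obtain f where f: "f \<in> J" "g - sc f g \<in> N"
      by (auto simp: U_def)
    then have "1 - f \<in> I"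
      by (simp add: I_def scale_left_diff_distrib)
    then show False
      using f J ring_ideal_add[OF J(1), of f "1 - f"] by auto
  qed
  have "sc (T i - Poly_Mapping.single 0 (w i)) h \<in> U" if "i \<in> A" "h \<in> G" for i h
  proof -
    define s where "s = T i - Poly_Mapping.single 0 (w i)"
    \<comment> \<open>Since \<open>h\<close> is \<open>f g\<close> modulo \<open>N\<close>,
      multiplying it by \<open>s\<close> gives \<open>(f s) g\<close> with \<open>f s\<close> in
      \<open>J\<close>.\<close>
    obtain f where f: "h - sc f g \<in> N"
      using Gsub \<open>h \<in> G\<close> unfolding span_insert N_def by blast
    have "f * s \<in> J"
      unfolding s_def using J \<open>i \<in> A\<close> ring_ideal_mult by blast
    moreover have "sc s h - sc (f * s) g \<in> N"
      using subspace_scale[OF N f, of s] by (simp add: scale_right_diff_distrib mult.commute)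
    ultimately show ?thesis
      unfolding U_def s_def by blast
  qed
  moreover have "M \<subseteq> U"
    using NU by (auto simp: N_def intro: span_base)
  ultimately show ?thesis
    using U g gU by blast
qed

section \<open>Laurent vectors and their pairing with velocity fields\<close>

type_synonym 'd laurent = "(int^'d) \<Rightarrow>\<^sub>0 complex"

definition spair :: "'d laurent \<Rightarrow> (int^'d \<Rightarrow> complex) \<Rightarrow> complex" where
  "spair f h = (\<Sum>k\<in>Poly_Mapping.keys f. Poly_Mapping.lookup f k * h (-k))"

lemma spair_superset:
  "finite S \<Longrightarrow> Poly_Mapping.keys f \<subseteq> S \<Longrightarrow> spair f h = (\<Sum>k\<in>S. Poly_Mapping.lookup f k * h (-k))"
  unfolding spair_def by (rule sum.mono_neutral_left) (auto simp: in_keys_iff)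

lemma spair_0 [simp]: "spair 0 h = 0"
  by (simp add: spair_def)

lemma spair_single [simp]: "spair (Poly_Mapping.single s c) h = c * h (-s)"
  by (simp add: spair_def)

lemma spair_add: "spair (f + g) h = spair f h + spair g h"
proof -
  let ?S = "Poly_Mapping.keys f \<union> Poly_Mapping.keys g"
  have "spair (f + g) h = (\<Sum>k\<in>?S. Poly_Mapping.lookup (f + g) k * h (-k))"
    using keys_add[of f g] by (intro spair_superset) auto
  also have "\<dots> = spair f h + spair g h"
    by (subst (1 2) spair_superset[of ?S]) (auto simp: lookup_add sum.distrib algebra_simps)
  finally show ?thesis .
qed

lemma spair_sum: "spair (sum f A) h = (\<Sum>i\<in>A. spair (f i) h)"
  by (induction A rule: infinite_finite_induct) (simp_all add: spair_add)

text \<open>Multiplication by a monomial is dual to translation. Through this rule, difference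
  operators and multi-factors of fields become multiplications on the Laurent side.\<close>

lemma spair_single_mult: "spair (Poly_Mapping.single s c * f) h = c * spair f (\<lambda>k. h (k - s))"
proof -
  have "spair (Poly_Mapping.single s c * f) h
      = spair (\<Sum>k\<in>Poly_Mapping.keys f. Poly_Mapping.single (s + k) (c * Poly_Mapping.lookup f k)) h"
    by (subst (1) poly_mapping_sum_single) (simp add: sum_distrib_left mult_single)
  also have "\<dots> = c * spair f (\<lambda>k. h (k - s))"
    unfolding spair_sum spair_single unfolding spair_def
    by (simp add: sum_distrib_left mult.assoc add.commute[of s])
  finally show ?thesis .
qed

text \<open>Puts the product of the monoid algebra into the convolution form in which
  \<open>lmult\<close> is defined.\<close>

lemma lookup_mult_sum:
  fixes f g :: "'d::finite laurent"
  shows "Poly_Mapping.lookup (f * g) t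
    = (\<Sum>s\<in>Poly_Mapping.keys f. Poly_Mapping.lookup f s * Poly_Mapping.lookup g (t - s))"
proof -
  have single: "Poly_Mapping.lookup (Poly_Mapping.single s c * g) t = c * Poly_Mapping.lookup g (t - s)" for s c
  proof -
    have "Poly_Mapping.single s c * g
        = (\<Sum>k\<in>Poly_Mapping.keys g. Poly_Mapping.single (s + k) (c * Poly_Mapping.lookup g k))"
      by (subst (1) poly_mapping_sum_single) (simp add: sum_distrib_left mult_single)
    then have "Poly_Mapping.lookup (Poly_Mapping.single s c * g) t
        = (\<Sum>k\<in>Poly_Mapping.keys g. if k = t - s then c * Poly_Mapping.lookup g k else 0)"
      by (simp only: lookup_sum lookup_single when_def eq_diff_eq add.commute)
    also have "\<dots> = c * Poly_Mapping.lookup g (t - s)"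
      by (simp add: in_keys_iff)
    finally show ?thesis .
  qed
  have "f * g = (\<Sum>s\<in>Poly_Mapping.keys f. Poly_Mapping.single s (Poly_Mapping.lookup f s) * g)"
    by (subst (1) poly_mapping_sum_single) (simp add: sum_distrib_right)
  then show ?thesis
    by (simp add: lookup_sum single)
qed

text \<open>Laurent vectors as vectors with Laurent polynomial entries, so that the module structure
  is at hand. \<open>lvec_of\<close> leads back to the coefficient families in which
  \<open>module_C\<close> and \<open>module_rig\<close> are stated.\<close>

type_synonym ('v,'d) lmod = "'d laurent ^ ('v \<times> 'd)"

definition wpair :: "('v::finite,'d::finite) lmod \<Rightarrow> ('v,'d) vfield \<Rightarrow> complex" where
  "wpair P u = (\<Sum>c\<in>UNIV. spair (P$c) (\<lambda>k. u (fst c) k (snd c)))"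

lemma wpair_0 [simp]: "wpair 0 u = 0"
  by (simp add: wpair_def)

lemma wpair_add: "wpair (P + Q) u = wpair P u + wpair Q u"
  by (simp add: wpair_def spair_add sum.distrib)

lemma wpair_sum: "wpair (sum P A) u = (\<Sum>i\<in>A. wpair (P i) u)"
  by (induction A rule: infinite_finite_induct) (simp_all add: wpair_add)

lemma wpair_single:
  "wpair (Poly_Mapping.single s c *s P) u = c * wpair P (\<lambda>x k j. u x (k - s) j)"
  by (simp add: wpair_def spair_single_mult sum_distrib_left)

lemma wpair_scale: "wpair (Poly_Mapping.single 0 c *s P) u = c * wpair P u"
  by (simp add: wpair_single)

lemma wpair_diff: "wpair (P - Q) u = wpair P u - wpair Q u"
  using wpair_add[of "P - Q" Q u] by simp

lemma wpair_field_scale: "wpair P (\<lambda>x k j. c * u x k j) = c * wpair P u"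
  by (simp add: wpair_def spair_def sum_distrib_left algebra_simps)

lemma wpair_field_add: "wpair P (\<lambda>x k j. u x k j + u' x k j) = wpair P u + wpair P u'"
  by (simp add: wpair_def spair_def sum.distrib algebra_simps)

lemma wpair_field_sum: "wpair P (\<lambda>x k j. \<Sum>i\<in>A. u i x k j) = (\<Sum>i\<in>A. wpair P (u i))"
proof (induction A rule: infinite_finite_induct)
  case (insert i A)
  then show ?case by (simp add: wpair_field_add)
qed (simp_all add: wpair_def spair_def)

lemma wpair_axis: "wpair (axis (x,j) (Poly_Mapping.single k c)) u = c * u x (-k) j"
proof -
  have "wpair (axis (x,j) (Poly_Mapping.single k c)) u
      = (\<Sum>b\<in>UNIV. if b = (x,j) then c * u x (-k) j else 0)"
    unfolding wpair_def by (intro sum.cong) (auto simp: axis_def)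
  then show ?thesis by simp
qed

section \<open>Laurent vectors as a module over the Laurent ring and as a complex vector
  space\<close>

interpretation lm: module "(*s) :: 'd laurent \<Rightarrow> ('v::finite,'d::finite) lmod \<Rightarrow> ('v,'d) lmod"
  by unfold_locales (vector algebra_simps)+

interpretation lv: vector_space
  "\<lambda>c (P :: ('v::finite,'d::finite) lmod). Poly_Mapping.single 0 c *s P"
  by unfold_locales
    (simp_all add: lm.scale_right_distrib lm.scale_left_distrib single_add mult_single
      vector_smult_assoc flip: one_poly_mapping_def)

interpretation lvp: vector_space_pair
  "\<lambda>c (P :: ('v::finite,'d::finite) lmod). Poly_Mapping.single 0 c *s P" "(*) :: complex \<Rightarrow> _" ..

lemma lmod_sum_monomials:
  fixes P :: "('v::finite,'d::finite) lmod"
  shows "P = (\<Sum>c\<in>UNIV. \<Sum>k\<in>Poly_Mapping.keys (P$c).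
         Poly_Mapping.single 0 (Poly_Mapping.lookup (P$c) k) *s axis c (Poly_Mapping.single k 1))"
proof -
  have "(\<Sum>c\<in>UNIV. \<Sum>k\<in>Poly_Mapping.keys (P$c).
         Poly_Mapping.single 0 (Poly_Mapping.lookup (P$c) k) *s axis c (Poly_Mapping.single k 1)) $ b = P $ b" for b
  proof -
    have "(\<Sum>c\<in>UNIV. \<Sum>k\<in>Poly_Mapping.keys (P$c).
         Poly_Mapping.single 0 (Poly_Mapping.lookup (P$c) k) *s axis c (Poly_Mapping.single k 1)) $ b
       = (\<Sum>c\<in>UNIV. if c = b then (\<Sum>k\<in>Poly_Mapping.keys (P$c). Poly_Mapping.single k (Poly_Mapping.lookup (P$c) k)) else 0)"
      unfolding sum_component 
    proof (intro sum.cong refl)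
      fix c
      show "(\<Sum>k\<in>Poly_Mapping.keys (P$c).
          (Poly_Mapping.single 0 (Poly_Mapping.lookup (P$c) k) *s axis c (Poly_Mapping.single k 1)) $ b)
        = (if c = b then (\<Sum>k\<in>Poly_Mapping.keys (P$c). Poly_Mapping.single k (Poly_Mapping.lookup (P$c) k)) else 0)"
        by (cases "c = b") (simp_all add: axis_def mult_single)
    qed
    also have "\<dots> = P $ b"
      using poly_mapping_sum_single[of "P $ b"] by simp
    finally show ?thesis .
  qed
  then show ?thesis by (simp add: vec_eq_iff)
qed

text \<open>A linear functional vanishing on \<open>U\<close> and equal to 1 at \<open>x\<close>
  exists by extending a basis. The monomial vectors form a basis of the Laurent vectors, so every
  functional is the pairing with some velocity field.\<close>

lemma exists_separating_field:
  fixes x :: "('v::finite,'d::finite) lmod"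
  assumes U: "lv.subspace U" and x: "x \<notin> U"
  obtains u where "\<And>P. P \<in> U \<Longrightarrow> wpair P u = 0" "wpair x u = 1"
proof -
  obtain B where B: "B \<subseteq> U" "lv.independent B" "U \<subseteq> lv.span B"
    using lv.maximal_independent_subset by blast
  have "lv.span B \<subseteq> U"
    using B(1) U by (rule lv.span_minimal)
  with x B have "lv.independent (insert x B)"
    by (intro lv.independent_insertI) auto
  then obtain g where g: "Vector_Spaces.linear (\<lambda>c P. Poly_Mapping.single 0 c *s P) (*) g"
      "\<And>y. y \<in> insert x B \<Longrightarrow> g y = (if y = x then 1 else 0)"
    using lvp.linear_independent_extend[of "insert x B" "\<lambda>y. if y = x then 1 else 0"] by blast
  interpret g: Vector_Spaces.linear "\<lambda>c P. Poly_Mapping.single 0 c *s P" "(*)" g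
    by (rule g(1))
  \<comment> \<open>The field records the values of \<open>g\<close> at monomials; the exponent
    \<open>-k\<close> undoes the sign in the pairing.\<close>
  define u where "u = (\<lambda>v k j. g (axis (v,j) (Poly_Mapping.single (-k) 1)))"
  have gu: "wpair P u = g P" for P
  proof -
    have "g P = (\<Sum>c\<in>UNIV. \<Sum>k\<in>Poly_Mapping.keys (P$c).
         Poly_Mapping.lookup (P$c) k * g (axis c (Poly_Mapping.single k 1)))"
      by (subst (1) lmod_sum_monomials) (simp add: g.sum g.scale)
    then show ?thesis
      by (simp add: wpair_def spair_def u_def)
  qed
  have "g P = 0" if "P \<in> U" for P
  proof -
    have "P \<in> lv.span B" using that B by auto
    then show ?thesis
    proof (rule g.eq_0_on_span[rotated])
      show "g y = 0" if "y \<in> B" for y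
        using g(2)[of y] that B(1) x by auto
    qed
  qed
  then show thesis
    using that[of u] gu g(2)[of x] by auto
qed

lemma wpair_scale_eq_0:
  assumes "\<And>t. wpair (Poly_Mapping.single t 1 *s P) u = 0"
  shows "wpair (f *s P) u = 0"
proof -
  have "f *s P = (\<Sum>k\<in>Poly_Mapping.keys f.
      Poly_Mapping.single 0 (Poly_Mapping.lookup f k) *s (Poly_Mapping.single k 1 *s P))"
    by (subst (1) poly_mapping_sum_single) (simp add: lm.scale_sum_left vector_smult_assoc mult_single)
  then show ?thesis
    using assms by (simp add: wpair_sum wpair_scale del: vector_smult_assoc lm.scale_scale)
qed

lemma lm_subspace_imp_lv: "lm.subspace U \<Longrightarrow> lv.subspace U"
  by (simp add: lm.subspace_def lv.subspace_def)

section \<open>Flexes, rigid motions and their annihilators\<close>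

lemma sum_UNIV_prod:
  "sum g (UNIV :: ('a::finite \<times> 'b::finite) set) = (\<Sum>x\<in>UNIV. \<Sum>y\<in>UNIV. g (x, y))"
  by (simp add: sum.cartesian_product)

lemma sum_UNIV_sum:
  "sum g (UNIV :: ('a::finite + 'b::finite) set) = (\<Sum>x\<in>UNIV. g (Inl x)) + (\<Sum>y\<in>UNIV. g (Inr y))"
  unfolding UNIV_Plus_UNIV[symmetric] by (subst sum.Plus) auto

lemma sum_UNIV_fst_delta:
  fixes g :: "'v::finite \<times> 'd::finite \<Rightarrow> 'c::comm_monoid_add"
  shows "(\<Sum>c\<in>UNIV. if fst c = v then g c else 0) = (\<Sum>j\<in>UNIV. g (v, j))"
proof -
  have "(\<Sum>c\<in>UNIV. if fst c = v then g c else 0) = (\<Sum>x\<in>UNIV. \<Sum>j\<in>UNIV. if x = v then g (x, j) else 0)"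
    by (simp add: sum_UNIV_prod)
  also have "\<dots> = (\<Sum>x\<in>UNIV. if x = v then (\<Sum>j\<in>UNIV. g (v, j)) else 0)"
    by (intro sum.cong) auto
  finally show ?thesis by simp
qed

section \<open>The rows of the transfer function and the module generated by them\<close>

definition lmrow :: "('v \<Rightarrow> real^'d) \<Rightarrow> ('d \<Rightarrow> real^'d) \<Rightarrow> ('v,'d) medge \<Rightarrow> ('v::finite,'d::finite) lmod" where
  "lmrow p0 a x = (case x of ((v,k),(w,l)) \<Rightarrow> \<chi> c.
     (if fst c = v then Poly_Mapping.single (-k) (complex_of_real (pedge p0 a x $ snd c)) else 0)
   - (if fst c = w then Poly_Mapping.single (-l) (complex_of_real (pedge p0 a x $ snd c)) else 0))"

lemma spair_diff: "spair (f - g) h = spair f h - spair g h"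
  using spair_add[of "f - g" g h] by simp

lemma wpair_lmrow:
  "wpair (lmrow p0 a ((v,k),(w,l))) u
    = (\<Sum>j\<in>UNIV. (u v k j - u w l j) * complex_of_real ((pos p0 a v k - pos p0 a w l) $ j))"
proof -
  let ?p = "\<lambda>j. complex_of_real ((pos p0 a v k - pos p0 a w l) $ j)"
  have "wpair (lmrow p0 a ((v,k),(w,l))) u
    = (\<Sum>c\<in>UNIV. (if fst c = v then ?p (snd c) * u (fst c) k (snd c) else 0)
        - (if fst c = w then ?p (snd c) * u (fst c) l (snd c) else 0))"
    unfolding wpair_def by (intro sum.cong) (auto simp: lmrow_def pedge_def spair_diff)
  also have "\<dots> = (\<Sum>j\<in>UNIV. ?p j * u v k j) - (\<Sum>j\<in>UNIV. ?p j * u w l j)"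
    unfolding sum_subtractf sum_UNIV_fst_delta by simp
  finally show ?thesis
    by (simp add: sum_subtractf[symmetric] algebra_simps)
qed

lemma pos_translate: "pos p0 a v (k + t) = pos p0 a v k + (\<Sum>i\<in>UNIV. of_int (t$i) *\<^sub>R a i)"
  by (simp add: pos_def sum.distrib scaleR_add_left)

lemma wpair_translate_lmrow:
  "wpair (Poly_Mapping.single t 1 *s lmrow p0 a ((v,k),(w,l))) u
    = (\<Sum>j\<in>UNIV. (u v (k - t) j - u w (l - t) j)
        * complex_of_real ((pos p0 a v (k - t) - pos p0 a w (l - t)) $ j))"
  using pos_translate[of p0 a v k "-t"] pos_translate[of p0 a w l "-t"]
  by (simp add: wpair_single wpair_lmrow)

text \<open>The row times the monomial with exponent \<open>t\<close> pairs to the equation of the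
  edge translated by \<open>-t\<close>. As \<open>t\<close> runs through the whole lattice, all edge
  equations occur.\<close>

lemma is_flex_iff_wpair:
  "is_flex p0 a edg u \<longleftrightarrow> (\<forall>e t. wpair (Poly_Mapping.single t 1 *s lmrow p0 a (edg e)) u = 0)"
proof
  assume flex: "is_flex p0 a edg u"
  show "\<forall>e t. wpair (Poly_Mapping.single t 1 *s lmrow p0 a (edg e)) u = 0"
  proof (intro allI)
    fix e t
    obtain v k w l where e: "edg e = ((v,k),(w,l))"
      by (metis surj_pair)
    show "wpair (Poly_Mapping.single t 1 *s lmrow p0 a (edg e)) u = 0"
      using flex[unfolded is_flex_def, rule_format, OF e, of "-t"]
      by (simp add: e wpair_translate_lmrow)
  qed
next
  assume *: "\<forall>e t. wpair (Poly_Mapping.single t 1 *s lmrow p0 a (edg e)) u = 0"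
  show "is_flex p0 a edg u"
    unfolding is_flex_def
  proof (intro allI impI)
    fix e v k w l t assume e: "edg e = ((v,k),(w,l))"
    show "(\<Sum>j\<in>UNIV. (u v (k + t) j - u w (l + t) j)
              * complex_of_real ((pos p0 a v (k + t) - pos p0 a w (l + t)) $ j)) = 0"
      using *[rule_format, of "-t" e] by (simp add: e wpair_translate_lmrow)
  qed
qed

definition flexmod :: "('v \<Rightarrow> real^'d) \<Rightarrow> ('d \<Rightarrow> real^'d) \<Rightarrow> ('e::finite \<Rightarrow> ('v,'d) medge) \<Rightarrow> ('v::finite,'d::finite) lmod set" where
  "flexmod p0 a edg = range (\<lambda>f. \<Sum>e\<in>UNIV. f e *s lmrow p0 a (edg e))"

lemma subspace_flexmod: "lm.subspace (flexmod p0 a edg)"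
proof (rule lm.subspaceI)
  show "0 \<in> flexmod p0 a edg"
    unfolding flexmod_def by (rule range_eqI[of _ _ "\<lambda>_. 0"]) simp
  show "x + y \<in> flexmod p0 a edg" if xy: "x \<in> flexmod p0 a edg" "y \<in> flexmod p0 a edg" for x y
  proof -
    obtain f g where "x = (\<Sum>e\<in>UNIV. f e *s lmrow p0 a (edg e))" "y = (\<Sum>e\<in>UNIV. g e *s lmrow p0 a (edg e))"
      using xy by (auto simp: flexmod_def)
    then show ?thesis
      unfolding flexmod_def
      by (intro range_eqI[of _ _ "\<lambda>e. f e + g e"]) (simp add: lm.scale_left_distrib sum.distrib)
  qed
  show "r *s x \<in> flexmod p0 a edg" if x: "x \<in> flexmod p0 a edg" for r x
  proof -
    obtain f where "x = (\<Sum>e\<in>UNIV. f e *s lmrow p0 a (edg e))"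
      using x by (auto simp: flexmod_def)
    then show ?thesis
      unfolding flexmod_def
      by (intro range_eqI[of _ _ "\<lambda>e. r * f e"]) (simp add: lm.scale_sum_right)
  qed
qed

lemma lmrow_in_flexmod: "lmrow p0 a (edg e) \<in> flexmod p0 a edg"
  unfolding flexmod_def
  by (rule range_eqI[of _ _ "\<lambda>e'. if e' = e then 1 else 0"])
    (simp add: if_distrib[of "\<lambda>f. f *s _"] cong: if_cong)

text \<open>The monomial multiples of the rows span the module over the complex numbers, so the edge
  equations say precisely that the field annihilates the module.\<close>

lemma is_flex_iff_annihilates: "is_flex p0 a edg u \<longleftrightarrow> (\<forall>P\<in>flexmod p0 a edg. wpair P u = 0)"
proof
  assume "is_flex p0 a edg u"
  then have "wpair (f *s lmrow p0 a (edg e)) u = 0" for f e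
    by (rule_tac wpair_scale_eq_0) (simp add: is_flex_iff_wpair)
  then show "\<forall>P\<in>flexmod p0 a edg. wpair P u = 0"
    by (auto simp: flexmod_def wpair_sum)
next
  assume "\<forall>P\<in>flexmod p0 a edg. wpair P u = 0"
  then show "is_flex p0 a edg u"
    unfolding is_flex_iff_wpair using lm.subspace_scale[OF subspace_flexmod lmrow_in_flexmod] by blast
qed

section \<open>Comparison with finitely supported coefficient families\<close>

definition lvec_of :: "('v::finite,'d::finite) lmod \<Rightarrow> ('v,'d) lvec" where
  "lvec_of P = (\<lambda>k x j. Poly_Mapping.lookup (P $ (x,j)) k)"

lemma inj_lvec_of: "inj lvec_of"
proof (rule injI)
  fix P Q :: "('v::finite,'d::finite) lmod" assume "lvec_of P = lvec_of Q"
  then have "Poly_Mapping.lookup (P $ (x,j)) k = Poly_Mapping.lookup (Q $ (x,j)) k" for x j k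
    unfolding lvec_of_def by metis
  then have "P $ (x,j) = Q $ (x,j)" for x j
    by (simp add: poly_mapping_eqI)
  then show "P = Q"
    by (simp add: vec_eq_iff)
qed

lemma lsupp_lvec_of: "lsupp (lvec_of P) = (\<Union>c. Poly_Mapping.keys (P $ c))"
  by (auto simp: lsupp_def lvec_of_def in_keys_iff)

lemma finite_lsupp_lvec_of: "finite (lsupp (lvec_of P))"
  by (simp add: lsupp_lvec_of)

lemma lvec_of_surj:
  assumes "finite (lsupp P)"
  obtains Q where "P = lvec_of Q"
proof
  have "finite {k. P k x j \<noteq> 0}" for x j
    by (rule finite_subset[OF _ assms]) (auto simp: lsupp_def)
  then show "P = lvec_of (\<chi> c. Abs_poly_mapping (\<lambda>k. P k (fst c) (snd c)))"
    by (simp add: lvec_of_def)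
qed

lemma lpair_lvec_of: "lpair (lvec_of P) u = wpair P u"
proof -
  let ?S = "\<Union>c. Poly_Mapping.keys (P $ c)"
  have "wpair P u = (\<Sum>c\<in>UNIV. \<Sum>k\<in>?S. Poly_Mapping.lookup (P $ c) k * u (fst c) (-k) (snd c))"
    unfolding wpair_def by (intro sum.cong spair_superset) auto
  also have "\<dots> = (\<Sum>k\<in>?S. \<Sum>c\<in>UNIV. Poly_Mapping.lookup (P $ c) k * u (fst c) (-k) (snd c))"
    by (rule sum.swap)
  also have "\<dots> = lpair (lvec_of P) u"
    unfolding lpair_def lsupp_lvec_of
    by (simp add: lvec_of_def sum_UNIV_prod)
  finally show ?thesis by simp
qed

lemma lvec_of_lmrow: "lvec_of (lmrow p0 a x) = lrow p0 a x"
proof -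
  obtain v k w l where x: "x = ((v,k),(w,l))"
    by (metis surj_pair)
  show ?thesis
    unfolding x by (intro ext) (auto simp: lvec_of_def lmrow_def lrow_def lookup_minus lookup_single when_def)
qed

lemma lmult_lvec_of: "lmult (Poly_Mapping.lookup f) (lvec_of P) = lvec_of (f *s P)"
proof -
  have "{s. Poly_Mapping.lookup f s \<noteq> 0} = Poly_Mapping.keys f"
    by (auto simp: in_keys_iff)
  then show ?thesis
    by (simp add: lmult_def lvec_of_def lookup_mult_sum)
qed

lemma lvec_of_row_sum:
  "lvec_of (\<Sum>e\<in>UNIV. f e *s lmrow p0 a (edg e))
    = (\<lambda>t x j. \<Sum>e\<in>UNIV. lmult (Poly_Mapping.lookup (f e)) (lrow p0 a (edg e)) t x j)"
  unfolding lvec_of_lmrow[symmetric] lmult_lvec_of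
  by (simp add: lvec_of_def lookup_sum)

lemma module_C_eq: "module_C p0 a edg = lvec_of ` flexmod p0 a edg"
proof (intro equalityI subsetI)
  fix P assume "P \<in> module_C p0 a edg"
  then obtain f where f: "\<And>e. lfin (f e)"
      "P = (\<lambda>t x j. \<Sum>e\<in>UNIV. lmult (f e) (lrow p0 a (edg e)) t x j)"
    by (auto simp: module_C_def)
  define F where "F = (\<lambda>e. Abs_poly_mapping (f e))"
  have "Poly_Mapping.lookup (F e) = f e" for e
    using f(1)[of e] by (simp add: F_def lfin_def)
  then have "P = lvec_of (\<Sum>e\<in>UNIV. F e *s lmrow p0 a (edg e))"
    unfolding lvec_of_row_sum f(2) by simp
  then show "P \<in> lvec_of ` flexmod p0 a edg"
    by (auto simp: flexmod_def)
next
  fix P assume "P \<in> lvec_of ` flexmod p0 a edg"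
  then obtain f where f: "P = lvec_of (\<Sum>e\<in>UNIV. f e *s lmrow p0 a (edg e))"
    by (auto simp: flexmod_def)
  show "P \<in> module_C p0 a edg"
    unfolding f lvec_of_row_sum module_C_def
    by (intro CollectI exI[of _ "\<lambda>e. Poly_Mapping.lookup (f e)"]) (simp add: lfin_def)
qed

section \<open>The rigidity module and complex rigid motions\<close>

definition rigmod :: "('v \<Rightarrow> real^'d) \<Rightarrow> ('d \<Rightarrow> real^'d) \<Rightarrow> ('v::finite,'d::finite) lmod set" where
  "rigmod p0 a = {P. \<forall>u\<in>flexes_rig p0 a. wpair P u = 0}"

lemma module_rig_eq: "module_rig p0 a = lvec_of ` rigmod p0 a"
proof (intro equalityI subsetI)
  fix P assume P: "P \<in> module_rig p0 a"
  then obtain Q where "P = lvec_of Q"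
    using lvec_of_surj by (auto simp: module_rig_def)
  with P show "P \<in> lvec_of ` rigmod p0 a"
    by (auto simp: module_rig_def rigmod_def lpair_lvec_of)
qed (auto simp: module_rig_def rigmod_def lpair_lvec_of finite_lsupp_lvec_of)

lemma module_eq_iff: "module_C p0 a edg = module_rig p0 a \<longleftrightarrow> flexmod p0 a edg = rigmod p0 a"
  unfolding module_C_eq module_rig_eq by (rule inj_image_eq_iff[OF inj_lvec_of])

definition crig :: "('v \<Rightarrow> real^'d) \<Rightarrow> ('d::finite \<Rightarrow> real^'d) \<Rightarrow> ('d \<Rightarrow> 'd \<Rightarrow> complex) \<Rightarrow> ('d \<Rightarrow> complex) \<Rightarrow> ('v,'d) vfield" where
  "crig p0 a S b = (\<lambda>v k j. (\<Sum>i\<in>UNIV. S j i * complex_of_real (pos p0 a v k $ i)) + b j)"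

definition skew :: "('d \<Rightarrow> 'd \<Rightarrow> 'a::uminus) \<Rightarrow> bool" where
  "skew S \<longleftrightarrow> (\<forall>i j. S i j = - S j i)"

text \<open>Collecting complex multiples of real rigid motions gives a complex skew matrix and a
  complex translation. Conversely, real and imaginary parts exhibit such a field as a combination of
  two real rigid motions.\<close>

lemma flexes_rig_iff: "u \<in> flexes_rig p0 a \<longleftrightarrow> (\<exists>S b. skew S \<and> u = crig p0 a S b)"
proof
  assume "u \<in> flexes_rig p0 a"
  then obtain N c r where r: "\<forall>i<(N::nat). r i \<in> {rigid_motion p0 a S b |S b. transpose S = - S}"
      and u: "u = (\<lambda>v k j. \<Sum>i<N. c i * r i v k j)"
    unfolding flexes_rig_def cspan_def by blast
  from r have "\<forall>i. \<exists>S b. i < N \<longrightarrow> r i = rigid_motion p0 a S b \<and> transpose S = - S"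
    by blast
  then obtain S b where Sb: "\<And>i. i < N \<Longrightarrow> r i = rigid_motion p0 a (S i) (b i)"
      "\<And>i. i < N \<Longrightarrow> transpose (S i) = - S i"
    by metis
  have sk: "S n $ i $ j = - S n $ j $ i" if "n < N" for n i j
  proof -
    have "transpose (S n) $ j $ i = (- S n) $ j $ i"
      using Sb(2)[OF that] by simp
    then show ?thesis by (simp add: transpose_def)
  qed
  define T where "T = (\<lambda>i j. \<Sum>n<N. c n * complex_of_real (S n $ i $ j))"
  define d where "d = (\<lambda>j. \<Sum>n<N. c n * complex_of_real (b n $ j))"
  have "skew T"
    unfolding skew_def
  proof (intro allI)
    fix i j
    have "T i j = (\<Sum>n<N. - (c n * complex_of_real (S n $ j $ i)))"
      unfolding T_def
    proof (intro sum.cong refl)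
      fix n assume "n \<in> {..<N}"
      then show "c n * complex_of_real (S n $ i $ j) = - (c n * complex_of_real (S n $ j $ i))"
        by (subst sk) auto
    qed
    then show "T i j = - T j i"
      by (simp add: T_def sum_negf)
  qed
  moreover have "u = crig p0 a T d"
  proof (intro ext)
    fix v k j
    have "u v k j = (\<Sum>n<N. c n * ((\<Sum>i\<in>UNIV. complex_of_real (S n $ j $ i) * complex_of_real (pos p0 a v k $ i))
              + complex_of_real (b n $ j)))"
      unfolding u using Sb(1) by (intro sum.cong) (auto simp: rigid_motion_def matrix_vector_mult_def)
    also have "\<dots> = (\<Sum>n<N. \<Sum>i\<in>UNIV. c n * (complex_of_real (S n $ j $ i) * complex_of_real (pos p0 a v k $ i))) + d j"
      by (simp add: distrib_left sum.distrib sum_distrib_left d_def)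
    also have "\<dots> = crig p0 a T d v k j"
      unfolding crig_def T_def by (subst sum.swap) (simp add: sum_distrib_right mult.assoc)
    finally show "u v k j = crig p0 a T d v k j" .
  qed
  ultimately show "\<exists>S b. skew S \<and> u = crig p0 a S b" by blast
next
  assume "\<exists>S b. skew S \<and> u = crig p0 a S b"
  then obtain S b where S: "skew S" and u: "u = crig p0 a S b" by blast
  define r where "r = (\<lambda>n::nat. if n = 0 then rigid_motion p0 a (\<chi> i j. Re (S i j)) (\<chi> i. Re (b i))
       else rigid_motion p0 a (\<chi> i j. Im (S i j)) (\<chi> i. Im (b i)))"
  \<comment> \<open>The real part of the motion enters with coefficient 1, the imaginary part with
    coefficient \<open>\<i>\<close>.\<close>
  define c where "c = (\<lambda>n::nat. if n = 0 then 1 else \<i>)"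
  have sk: "Re (S i j) = - Re (S j i)" "Im (S i j) = - Im (S j i)" for i j
    using S by (metis skew_def uminus_complex.sel(1), metis skew_def uminus_complex.sel(2))
  have "\<forall>i<2. r i \<in> {rigid_motion p0 a S b |S b. transpose S = - S}"
  proof -
    have "transpose (\<chi> i j. Re (S i j)) = - (\<chi> i j. Re (S i j))"
        "transpose (\<chi> i j. Im (S i j)) = - (\<chi> i j. Im (S i j))"
      by (simp_all add: transpose_def vec_eq_iff) (use sk in blast)+
    then show ?thesis
      unfolding r_def by auto
  qed
  moreover have "u = (\<lambda>v k j. \<Sum>i<(2::nat). c i * r i v k j)"
  proof (intro ext)
    fix v k j
    show "u v k j = (\<Sum>i<(2::nat). c i * r i v k j)"
      by (simp add: u r_def c_def numeral_2_eq_2 crig_def rigid_motion_def matrix_vector_mult_def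
          complex_eq_iff)
  qed
  ultimately show "u \<in> flexes_rig p0 a"
    unfolding flexes_rig_def cspan_def by blast
qed

lemma skew_form_zero:
  fixes S :: "'d::finite \<Rightarrow> 'd \<Rightarrow> complex"
  assumes "skew S"
  shows "(\<Sum>j\<in>UNIV. \<Sum>i\<in>UNIV. S j i * q i * q j) = 0"
proof -
  have "(\<Sum>j\<in>UNIV. \<Sum>i\<in>UNIV. S j i * q i * q j) = (\<Sum>j\<in>UNIV. \<Sum>i\<in>UNIV. S i j * q j * q i)"
    by (rule sum.swap)
  also have "\<dots> = (\<Sum>j\<in>UNIV. \<Sum>i\<in>UNIV. - (S j i * q i * q j))"
    using assms by (intro sum.cong refl) (metis skew_def mult_minus_left mult.assoc mult.commute)
  finally show ?thesis
    by (simp add: sum_negf)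
qed

lemma is_flex_crig:
  assumes "skew S"
  shows "is_flex p0 a edg (crig p0 a S b)"
  unfolding is_flex_def
proof (intro allI impI)
  fix v w k l t
  let ?q = "\<lambda>i. complex_of_real ((pos p0 a v (k + t) - pos p0 a w (l + t)) $ i)"
  have "(\<Sum>j\<in>UNIV. (crig p0 a S b v (k + t) j - crig p0 a S b w (l + t) j) * ?q j)
     = (\<Sum>j\<in>UNIV. \<Sum>i\<in>UNIV. S j i * ?q i * ?q j)"
    by (intro sum.cong) (simp_all add: crig_def sum_distrib_right right_diff_distrib flip: sum_subtractf)
  then show "(\<Sum>j\<in>UNIV. (crig p0 a S b v (k + t) j - crig p0 a S b w (l + t) j) * ?q j) = 0"
    using skew_form_zero[OF assms] by simp
qed

lemma flexes_rig_subset: "flexes_rig p0 a \<subseteq> flexes p0 a edg"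
  by (auto simp: flexes_rig_iff flexes_def is_flex_crig)

text \<open>A finite-dimensional space of fields is its own double annihilator. The induction
  removes one spanning field at a time, using a Laurent vector that detects this field but none of
  the others.\<close>

lemma field_in_span_if:
  fixes u :: "('v::finite,'d::finite) vfield"
  assumes "finite A" "\<And>P. (\<And>i. i \<in> A \<Longrightarrow> wpair P (r i) = 0) \<Longrightarrow> wpair P u = 0"
  shows "\<exists>c. u = (\<lambda>v k j. \<Sum>i\<in>A. c i * r i v k j)"
  using assms
proof (induction A arbitrary: u rule: finite_induct)
  case empty
  have "u v k j = 0" for v k j
    using empty(1)[of "axis (v,j) (Poly_Mapping.single (-k) 1)"] by (simp add: wpair_axis)
  then show ?case by (intro exI ext) simp
next
  case (insert i A)
  show ?case
  proof (cases "\<exists>P. (\<forall>i\<in>A. wpair P (r i) = 0) \<and> wpair P (r i) \<noteq> 0")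
    case False
    \<comment> \<open>Here the condition at \<open>r i\<close> follows from those on
      \<open>A\<close>, so \<open>u\<close> is already spanned by the fields of \<open>A\<close> and
      the new coefficient is 0.\<close>
    then obtain c where c: "u = (\<lambda>v k j. \<Sum>i\<in>A. c i * r i v k j)"
      using insert by (metis insertE)
    have "(\<Sum>l\<in>A. (c(i := 0)) l * r l v k j) = (\<Sum>i\<in>A. c i * r i v k j)" for v k j
      using insert(2) by (intro sum.cong) auto
    then show ?thesis
      unfolding c using insert(1,2) by (intro exI[of _ "c(i := 0)"]) simp
  next
    case True
    then obtain P0 where P0: "\<And>i. i \<in> A \<Longrightarrow> wpair P0 (r i) = 0" "wpair P0 (r i) \<noteq> 0" by blast
    \<comment> \<open>Chosen so that \<open>P0\<close> annihilates \<open>u'\<close>.\<close>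
    define s where "s = wpair P0 u / wpair P0 (r i)"
    define u' where "u' = (\<lambda>v k j. u v k j + (- s) * r i v k j)"
    have wu': "wpair P u' = wpair P u - s * wpair P (r i)" for P
      unfolding u'_def by (subst wpair_field_add, subst wpair_field_scale) simp
    have "wpair P u' = 0" if P: "\<And>i. i \<in> A \<Longrightarrow> wpair P (r i) = 0" for P
    proof -
      \<comment> \<open>The multiple of \<open>P0\<close> makes \<open>Q\<close> annihilate
        \<open>r i\<close> as well, while its pairing with \<open>u\<close> equals the pairing of
        \<open>P\<close> with \<open>u'\<close>.\<close>
      define Q where "Q = P - Poly_Mapping.single 0 (wpair P (r i) / wpair P0 (r i)) *s P0"
      have "wpair Q (r l) = 0" if "l \<in> insert i A" for l
        using that P P0 by (auto simp: Q_def wpair_diff wpair_scale)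
      then have "wpair Q u = 0"
        using insert.prems by blast
      then show ?thesis
        by (simp add: wu' Q_def wpair_diff wpair_scale s_def)
    qed
    then obtain c where c: "u' = (\<lambda>v k j. \<Sum>i\<in>A. c i * r i v k j)"
      using insert.IH by blast
    have "u v k j = s * r i v k j + (\<Sum>i\<in>A. c i * r i v k j)" for v k j
      using fun_cong[OF fun_cong[OF fun_cong[OF c, of v], of k], of j] by (simp add: u'_def algebra_simps)
    moreover have "(\<Sum>l\<in>A. (c(i := s)) l * r l v k j) = (\<Sum>i\<in>A. c i * r i v k j)" for v k j
      using insert(2) by (intro sum.cong) auto
    ultimately have "u = (\<lambda>v k j. \<Sum>l\<in>insert i A. (c(i := s)) l * r l v k j)"
      using insert(1,2) by (intro ext) simp
    then show ?thesis by blast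
  qed
qed

text \<open>Coordinate translations and elementary rotations. The family spans but is redundant:
  \<open>(p,q)\<close> and \<open>(q,p)\<close> give opposite fields, and \<open>(p,p)\<close> gives
  zero.\<close>

definition rig_basis :: "('v \<Rightarrow> real^'d) \<Rightarrow> ('d::finite \<Rightarrow> real^'d) \<Rightarrow> 'd + 'd \<times> 'd \<Rightarrow> ('v,'d) vfield" where
  "rig_basis p0 a i = (\<lambda>v k j. case i of Inl q \<Rightarrow> (if j = q then 1 else 0)
     | Inr (p,q) \<Rightarrow> (if j = p then complex_of_real (pos p0 a v k $ q) else 0)
                  - (if j = q then complex_of_real (pos p0 a v k $ p) else 0))"

lemma sum_rig_basis:
  "(\<lambda>v k j. \<Sum>i\<in>UNIV. c i * rig_basis p0 a i v k j)
    = crig p0 a (\<lambda>j q. c (Inr (j,q)) - c (Inr (q,j))) (\<lambda>q. c (Inl q))"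
proof (intro ext)
  fix v k j
  let ?x = "\<lambda>i. complex_of_real (pos p0 a v k $ i)"
  have "(\<Sum>i\<in>UNIV. c i * rig_basis p0 a i v k j)
      = (\<Sum>q\<in>UNIV. c (Inl q) * (if j = q then 1 else 0))
      + (\<Sum>p\<in>UNIV. \<Sum>q\<in>UNIV. c (Inr (p,q)) * ((if j = p then ?x q else 0) - (if j = q then ?x p else 0)))"
    by (simp add: sum_UNIV_sum sum_UNIV_prod rig_basis_def)
  also have "(\<Sum>q\<in>UNIV. c (Inl q) * (if j = q then 1 else 0)) = c (Inl j)"
    by (simp add: if_distrib cong: if_cong)
  also have "(\<Sum>p\<in>UNIV. \<Sum>q\<in>UNIV. c (Inr (p,q)) * ((if j = p then ?x q else 0) - (if j = q then ?x p else 0)))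
      = (\<Sum>p\<in>UNIV. \<Sum>q\<in>UNIV. if p = j then c (Inr (p,q)) * ?x q else 0)
      - (\<Sum>p\<in>UNIV. \<Sum>q\<in>UNIV. if q = j then c (Inr (p,q)) * ?x p else 0)"
    unfolding sum_subtractf[symmetric] by (intro sum.cong refl) (auto simp: algebra_simps)
  also have "(\<Sum>p\<in>UNIV. \<Sum>q\<in>UNIV. if p = j then c (Inr (p,q)) * ?x q else 0)
      = (\<Sum>q\<in>UNIV. c (Inr (j,q)) * ?x q)"
    by (subst sum.swap) simp
  finally show "(\<Sum>i\<in>UNIV. c i * rig_basis p0 a i v k j)
      = crig p0 a (\<lambda>j q. c (Inr (j,q)) - c (Inr (q,j))) (\<lambda>q. c (Inl q)) v k j"
    by (simp add: crig_def algebra_simps sum_subtractf)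
qed

text \<open>The factor 1/2 accounts for each rotation plane occurring twice in
  \<open>rig_basis\<close>.\<close>

lemma crig_eq_sum_rig_basis:
  assumes "skew S"
  shows "crig p0 a S b = (\<lambda>v k j. \<Sum>i\<in>UNIV.
     (case i of Inl q \<Rightarrow> b q | Inr (p,q) \<Rightarrow> S p q / 2) * rig_basis p0 a i v k j)"
proof -
  have "S j q / 2 - S q j / 2 = S j q" for j q
  proof -
    have "S q j = - S j q"
      using assms unfolding skew_def by blast
    then show ?thesis by simp
  qed
  then show ?thesis
    by (subst sum_rig_basis) simp
qed

text \<open>In one direction, a Laurent vector outside \<open>flexmod\<close> is separated from it
  by a flex, which is rigid by assumption. In the other, a flex annihilates everything that
  annihilates the finite family \<open>rig_basis\<close>, so it lies in the span of that
  family.\<close>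

lemma flex_rig_iff_module_eq:
  "flexes p0 a edg = flexes_rig p0 a \<longleftrightarrow> module_C p0 a edg = module_rig p0 a"
  unfolding module_eq_iff
proof
  assume F: "flexes p0 a edg = flexes_rig p0 a"
  show "flexmod p0 a edg = rigmod p0 a"
  proof (intro equalityI subsetI)
    fix P assume "P \<in> flexmod p0 a edg"
    then show "P \<in> rigmod p0 a"
      using F[symmetric] by (auto simp: rigmod_def flexes_def is_flex_iff_annihilates)
  next
    fix P assume P: "P \<in> rigmod p0 a"
    show "P \<in> flexmod p0 a edg"
    proof (rule ccontr)
      assume "P \<notin> flexmod p0 a edg"
      then obtain u where u: "\<And>Q. Q \<in> flexmod p0 a edg \<Longrightarrow> wpair Q u = 0" "wpair P u = 1"
        using exists_separating_field[OF lm_subspace_imp_lv[OF subspace_flexmod]] by blast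
      then have "u \<in> flexes_rig p0 a"
        using F by (auto simp: flexes_def is_flex_iff_annihilates)
      with P u(2) show False by (auto simp: rigmod_def)
    qed
  qed
next
  assume M: "flexmod p0 a edg = rigmod p0 a"
  have "u \<in> flexes_rig p0 a" if u: "is_flex p0 a edg u" for u
  proof -
    have "wpair P u = 0" if P: "\<And>i. i \<in> UNIV \<Longrightarrow> wpair P (rig_basis p0 a i) = 0" for P
    proof -
      have "wpair P (crig p0 a S b) = 0" if "skew S" for S b
        unfolding crig_eq_sum_rig_basis[OF that]
        by (subst wpair_field_sum, intro sum.neutral ballI, subst wpair_field_scale) (simp add: P)
      then have "P \<in> rigmod p0 a"
        by (auto simp: rigmod_def flexes_rig_iff)
      then show ?thesis
        using u M by (auto simp: is_flex_iff_annihilates)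
    qed
    then obtain c where c: "u = (\<lambda>v k j. \<Sum>i\<in>UNIV. c i * rig_basis p0 a i v k j)"
      using field_in_span_if[OF finite_class.finite_UNIV] by blast
    show ?thesis
      unfolding flexes_rig_iff c sum_rig_basis by (intro exI conjI, rule_tac[2] refl) (simp add: skew_def)
  qed
  then show "flexes p0 a edg = flexes_rig p0 a"
    using flexes_rig_subset[of p0 a edg] by (auto simp: flexes_def)
qed

section \<open>Affine, rigid and factor-periodic fields are exponential\<close>

lemma cspan_add_generator:
  assumes "u \<in> cspan G" "r \<in> G"
  shows "(\<lambda>v k j. u v k j + c * r v k j) \<in> cspan G"
proof -
  obtain N d s where s: "\<forall>i<N. s i \<in> G" "u = (\<lambda>v k j. \<Sum>i<(N::nat). d i * s i v k j)"
    using assms by (auto simp: cspan_def)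
  show ?thesis
    unfolding cspan_def s(2) using s(1) assms(2)
    by (intro CollectI exI[of _ "Suc N"] exI[of _ "d(N := c)"] exI[of _ "s(N := r)"])
      (auto simp: less_Suc_eq)
qed

lemma cspan_add_generators:
  assumes "finite A" "u \<in> cspan G" "\<And>i. i \<in> A \<Longrightarrow> r i \<in> G"
  shows "(\<lambda>v k j. u v k j + (\<Sum>i\<in>A. c i * r i v k j)) \<in> cspan G"
  using assms(1,3)
proof (induction A)
  case (insert i A)
  have "(\<lambda>v k j. (u v k j + (\<Sum>i\<in>A. c i * r i v k j)) + c i * r i v k j) \<in> cspan G"
    using insert by (intro cspan_add_generator) auto
  then show ?case
    using insert(1,2) by (simp add: algebra_simps)
qed (use assms in simp)

lemma generator_in_cspan: "r \<in> G \<Longrightarrow> r \<in> cspan G"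
  unfolding cspan_def by (intro CollectI exI[of _ 1] exI[of _ "\<lambda>_. 1"] exI[of _ "\<lambda>_. r"]) auto

lemma is_poly_fun_1: "is_poly_fun (\<lambda>_. 1)"
  unfolding is_poly_fun_def by (intro exI[of _ "{0}"] exI[of _ "\<lambda>_. 1"]) simp

lemma is_poly_fun_coordinate: "is_poly_fun (\<lambda>k. of_int (k $ i))"
  unfolding is_poly_fun_def
  by (intro exI[of _ "{axis i 1}"] exI[of _ "\<lambda>_. 1"]) (simp add: axis_def if_distrib prod.If_cases cong: if_cong)

lemma mpow_1 [simp]: "mpow (\<chi> i. 1) k = 1"
  by (simp add: mpow_def)

text \<open>The constant term and one linear term for each lattice direction are generators with
  multi-factor 1.\<close>

lemma affine_in_V_exp:
  assumes u: "\<And>v k j. u v k j = B v j + (\<Sum>i\<in>UNIV. X j i * of_int (k $ i))"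
  shows "u \<in> V_exp"
proof -
  have "(\<lambda>v k j. 1 * mpow (\<chi> i. 1) k * B v j) \<in> V_exp"
    unfolding V_exp_def
    by (intro generator_in_cspan CollectI exI[of _ "\<lambda>_. 1"] exI[of _ "\<chi> i. 1"] exI[of _ B])
      (simp add: is_poly_fun_1)
  then have "(\<lambda>v k j. 1 * mpow (\<chi> i. 1) k * B v j
      + (\<Sum>i\<in>UNIV. 1 * (of_int (k $ i) * mpow (\<chi> i. 1) k * X j i))) \<in> V_exp"
    unfolding V_exp_def
    by (rule cspan_add_generators[OF finite_class.finite_UNIV])
      (intro CollectI exI conjI, rule refl, auto simp: is_poly_fun_coordinate)
  also have "(\<lambda>v k j. 1 * mpow (\<chi> i. 1) k * B v j
      + (\<Sum>i\<in>UNIV. 1 * (of_int (k $ i) * mpow (\<chi> i. 1) k * X j i))) = u"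
    by (intro ext) (simp add: u mult.commute)
  finally show ?thesis .
qed

lemma factor_periodic_in_V_exp:
  assumes "\<And>v k j. u v k j = mpow w k * u v 0 j" "\<And>i. w $ i \<noteq> 0"
  shows "u \<in> V_exp"
proof -
  have "(\<lambda>v k j. 1 * mpow w k * u v 0 j) \<in> V_exp"
    unfolding V_exp_def using assms(2)
    by (intro generator_in_cspan CollectI exI[of _ "\<lambda>_. 1"] exI[of _ w] exI[of _ "\<lambda>v j. u v 0 j"])
      (simp add: is_poly_fun_1)
  also have "(\<lambda>v k j. 1 * mpow w k * u v 0 j) = u"
    by (intro ext) (simp only: mult_1 assms(1)[symmetric])
  finally show ?thesis .
qed

lemma crig_translate:
  "crig p0 a S b v (k + t) j = crig p0 a S b v k j
     + (\<Sum>i\<in>UNIV. of_int (t $ i) * (\<Sum>l\<in>UNIV. S j l * complex_of_real (a i $ l)))"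
proof -
  have "(\<Sum>l\<in>UNIV. S j l * (\<Sum>i\<in>UNIV. of_int (t $ i) * complex_of_real (a i $ l)))
      = (\<Sum>i\<in>UNIV. of_int (t $ i) * (\<Sum>l\<in>UNIV. S j l * complex_of_real (a i $ l)))"
    unfolding sum_distrib_left by (subst sum.swap) (simp add: algebra_simps)
  then show ?thesis
    by (simp add: crig_def pos_translate distrib_left sum.distrib)
qed

lemma crig_affine:
  "crig p0 a S b v k j = crig p0 a S b v 0 j
     + (\<Sum>i\<in>UNIV. (\<Sum>l\<in>UNIV. S j l * complex_of_real (a i $ l)) * of_int (k $ i))"
  using crig_translate[of p0 a S b v 0 k j] by (simp add: mult.commute)

lemma flexes_rig_in_V_exp:
  assumes "u \<in> flexes_rig p0 a"
  shows "u \<in> V_exp"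
proof -
  obtain S b where u: "u = crig p0 a S b"
    using assms by (auto simp: flexes_rig_iff)
  show ?thesis
    unfolding u
    by (rule affine_in_V_exp[where B = "\<lambda>v j. crig p0 a S b v 0 j"
          and X = "\<lambda>j i. \<Sum>l\<in>UNIV. S j l * complex_of_real (a i $ l)"]) (rule crig_affine)
qed

section \<open>Finite differences of flexes\<close>

lemma is_flex_translate:
  assumes "is_flex p0 a edg u"
  shows "is_flex p0 a edg (\<lambda>v k j. u v (k + t) j)"
  unfolding is_flex_iff_wpair
proof (intro allI)
  fix e s
  have "wpair (Poly_Mapping.single s 1 *s lmrow p0 a (edg e)) (\<lambda>v k j. u v (k + t) j)
      = wpair (Poly_Mapping.single (s - t) 1 *s lmrow p0 a (edg e)) u"
    by (simp add: wpair_single algebra_simps)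
  then show "wpair (Poly_Mapping.single s 1 *s lmrow p0 a (edg e)) (\<lambda>v k j. u v (k + t) j) = 0"
    using assms by (simp add: is_flex_iff_wpair)
qed

definition fdiff :: "'d \<Rightarrow> ('v,'d) vfield \<Rightarrow> ('v,'d::finite) vfield" where
  "fdiff i u = (\<lambda>v k j. u v (k + axis i 1) j - u v k j)"

lemma wpair_field_diff: "wpair P (\<lambda>x k j. u x k j - u' x k j) = wpair P u - wpair P u'"
  using wpair_field_add[of P u "\<lambda>x k j. (-1) * u' x k j"] wpair_field_scale[of P "-1" u'] by simp

lemma is_flex_fdiff:
  assumes "is_flex p0 a edg u"
  shows "is_flex p0 a edg (fdiff i u)"
  using is_flex_translate[OF assms, of "axis i 1"] assms
  by (simp add: is_flex_iff_wpair fdiff_def wpair_field_diff)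

lemma fdiff_commute: "fdiff i (fdiff j u) = fdiff j (fdiff i u)"
  by (simp add: fdiff_def algebra_simps)

lemma axis_add: "axis i (m + n) = (axis i m + axis i n :: 'a::monoid_add^'n)"
  by (simp add: vec_eq_iff axis_def)

text \<open>The recursion can be run backwards because \<open>w\<close> has no zero coordinate,
  which covers negative exponents. Walking along the coordinate directions one by one then reaches
  \<open>k\<close> from 0.\<close>

lemma lattice_eigenfunction:
  fixes h :: "int^'d \<Rightarrow> complex"
  assumes h: "\<And>i k. h (k + axis i 1) = w $ i * h k" and w: "\<And>i. w $ i \<noteq> 0"
  shows "h k = mpow w k * h 0"
proof -
  have step: "h (k + axis i n) = (w $ i) powi n * h k" for i n k
  proof (induction n rule: int_induct[where k = 0])
    case base
    have zero: "axis i 0 = (0 :: int^'d)" by (simp add: vec_eq_iff axis_def)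
    show ?case unfolding zero by simp
  next
    case (step1 n)
    have "h (k + axis i (n + 1)) = w $ i * h (k + axis i n)"
      unfolding axis_add add.assoc[symmetric] by (rule h)
    then show ?case
      using step1 w by (simp add: power_int_add_1)
  next
    case (step2 n)
    have "h (k + axis i n) = h (k + axis i (n - 1) + axis i 1)"
      unfolding add.assoc axis_add[symmetric] by simp
    also have "\<dots> = w $ i * h (k + axis i (n - 1))"
      by (rule h)
    finally show ?case
      using step2 w by (simp add: power_int_diff field_simps)
  qed
  have "h (\<Sum>i\<in>A. axis i (k $ i)) = (\<Prod>i\<in>A. (w $ i) powi (k $ i)) * h 0" if "finite A" for A
    using that
  proof induction
    case (insert i A)
    then show ?case
      using step[of "\<Sum>i\<in>A. axis i (k $ i)" i "k $ i"] by (simp add: add.commute mult.assoc)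
  qed simp
  moreover have "(\<Sum>i\<in>UNIV. axis i (k $ i)) = k"
    by (simp add: vec_eq_iff axis_def)
  ultimately show ?thesis
    by (metis finite_class.finite_UNIV mpow_def)
qed

lemma lattice_periodic_const:
  fixes h :: "int^'d \<Rightarrow> complex"
  assumes "\<And>i k. h (k + axis i 1) = h k"
  shows "h k = h 0"
  using lattice_eigenfunction[of h "\<chi> i. 1" k] assms by simp

section \<open>Rigid fields and the spanning lattice vectors\<close>

lemma span_lattice_vectors:
  fixes a :: "'d::finite \<Rightarrow> real^'d"
  assumes "inj a" "independent (range a)"
  shows "span (range a) = UNIV"
proof -
  have "UNIV \<subseteq> span (range a)"
    using assms by (intro card_ge_dim_independent) (auto simp: card_image)
  then show ?thesis by auto
qed

lemma lattice_orthogonal_zero_real: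
  fixes a :: "'d::finite \<Rightarrow> real^'d"
  assumes "span (range a) = UNIV" and s: "\<And>i. (\<Sum>l\<in>UNIV. s l * a i $ l) = 0"
  shows "s l = 0"
proof -
  define x where "x = (\<chi> l. s l)"
  have "orthogonal x y" if "y \<in> range a" for y
    using that s by (auto simp: orthogonal_def inner_vec_def x_def)
  then have "orthogonal x x"
    using orthogonal_to_span[of x "range a" x] assms(1) by auto
  then have "x = 0"
    by (simp add: orthogonal_def)
  then show ?thesis
    by (metis x_def vec_lambda_beta zero_index)
qed

lemma lattice_orthogonal_zero:
  fixes a :: "'d::finite \<Rightarrow> real^'d" and s :: "'d \<Rightarrow> complex"
  assumes sp: "span (range a) = UNIV" and s: "\<And>i. (\<Sum>l\<in>UNIV. s l * complex_of_real (a i $ l)) = 0"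
  shows "s l = 0"
proof -
  have "(\<Sum>l\<in>UNIV. Re (s l) * a i $ l) = 0" "(\<Sum>l\<in>UNIV. Im (s l) * a i $ l) = 0" for i
    using arg_cong[OF s[of i], of Re] arg_cong[OF s[of i], of Im] by simp_all
  then show ?thesis
    using lattice_orthogonal_zero_real[OF sp, of "\<lambda>l. Re (s l)" l]
      lattice_orthogonal_zero_real[OF sp, of "\<lambda>l. Im (s l)" l]
    by (simp add: complex_eq_iff)
qed

lemma crig_translate_axis:
  "crig p0 a S b v (k + axis i 1) j = crig p0 a S b v k j + (\<Sum>l\<in>UNIV. S j l * complex_of_real (a i $ l))"
  unfolding crig_translate by (simp add: axis_def if_distrib[of of_int] if_distrib[of "\<lambda>x. x * _"] cong: if_cong)

lemma fdiff_crig: "fdiff i (crig p0 a S b) v k j = (\<Sum>l\<in>UNIV. S j l * complex_of_real (a i $ l))"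
  by (simp add: fdiff_def crig_translate_axis)

text \<open>Periodicity makes the skew part annihilate every lattice vector; as these span, it
  vanishes and only a translation remains.\<close>

lemma rig_periodic_const:
  assumes sp: "span (range a) = UNIV" and u: "u \<in> flexes_rig p0 a"
    and per: "\<And>i v k j. u v (k + axis i 1) j = u v k j"
  obtains b where "\<And>v k j. u v k j = b j"
proof -
  obtain S b where S: "u = crig p0 a S b"
    using u by (auto simp: flexes_rig_iff)
  have "(\<Sum>l\<in>UNIV. S j l * complex_of_real (a i $ l)) = 0" for i j
    using per[of undefined 0 i j] unfolding S crig_translate_axis by simp
  then have "S j l = 0" for j l
    using lattice_orthogonal_zero[OF sp, of "S j" l] by blast
  then have "u v k j = b j" for v k j
    by (simp add: S crig_def)
  then show thesis using that by blast
qed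

text \<open>A rigid field is affine along each lattice direction, so its second difference in
  direction \<open>i\<close> is zero. On an eigenvector of the shift this second difference is
  multiplication by \<open>(w - 1)^2\<close>.\<close>

lemma rig_factor_periodic_zero:
  assumes u: "u \<in> flexes_rig p0 a" and w: "w \<noteq> 1"
    and per: "\<And>v k j. u v (k + axis i 1) j = w * u v k j"
  shows "u v k j = 0"
proof -
  obtain S b where S: "u = crig p0 a S b"
    using u by (auto simp: flexes_rig_iff)
  define c where "c = (\<Sum>l\<in>UNIV. S j l * complex_of_real (a i $ l))"
  have 1: "u v k j + c = w * u v k j" for k
    unfolding c_def using per[of v k j] by (simp add: S crig_translate_axis)
  have "w * u v k j + c = w * (w * u v k j)"
    using 1[of "k + axis i 1"] by (simp add: per)
  moreover have "c = w * u v k j - u v k j"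
    using 1[of k] by (simp add: algebra_simps)
  ultimately have "w * (w * u v k j) - (w * u v k j + (w * u v k j - u v k j)) = 0"
    by simp
  then have "(w - 1) * ((w - 1) * u v k j) = 0"
    by (simp add: algebra_simps)
  then show ?thesis using w by simp
qed

text \<open>This excludes flexes that are polynomial of degree two in the lattice coordinates.\<close>

lemma symmetric_skew_zero:
  fixes A :: "'i \<Rightarrow> 'i \<Rightarrow> 'i \<Rightarrow> complex"
  assumes sym: "\<And>i j n. A i j n = A j i n" and sk: "\<And>i j n. A i j n = - A n j i"
  shows "A i j n = 0"
proof -
  have "A i j n = - A n j i" by (rule sk)
  also have "\<dots> = - A j n i" using sym by simp
  also have "\<dots> = A i n j" using sk[of j n i] by simp
  also have "\<dots> = A n i j" by (rule sym)
  also have "\<dots> = - A j i n" by (rule sk)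
  also have "\<dots> = - A i j n" using sym by simp
  finally show ?thesis by simp
qed

section \<open>Flexes under condition (iii)\<close>

locale no_special_flexes =
  fixes p0 :: "'v::finite \<Rightarrow> real^'d::finite" and a :: "'d \<Rightarrow> real^'d"
    and edg :: "'e::finite \<Rightarrow> ('v,'d) medge"
  assumes sp: "span (range a) = UNIV"
    and factor: "\<And>w u. (\<And>i. w $ i \<noteq> 0) \<Longrightarrow> factor_periodic_flex p0 a edg w u \<Longrightarrow> u \<in> flexes_rig p0 a"
    and flexible: "\<And>u. flexible_lattice_periodic_flex p0 a edg u \<Longrightarrow> u \<in> flexes_rig p0 a"
begin

text \<open>The first differences are periodic flexes, that is, factor-periodic with multi-factor 1,
  hence rigid and therefore constant. So \<open>u\<close> is affine in the lattice point, and the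
  hypothesis on flexible lattice periodic flexes applies.\<close>

lemma affine_flex_rigid:
  assumes u: "is_flex p0 a edg u" and D: "\<And>i j. fdiff i (fdiff j u) = (\<lambda>v k m. 0)"
  shows "u \<in> flexes_rig p0 a"
proof -
  have "\<exists>b. \<forall>v k j. fdiff i u v k j = b j" for i
  proof -
    have per: "fdiff i u v (k + axis l 1) j = fdiff i u v k j" for l v k j
      using fun_cong[OF fun_cong[OF fun_cong[OF D[of l i], of v], of k], of j]
      by (simp add: fdiff_def[of l])
    have "fdiff i u v k j = fdiff i u v 0 j" for v k j
      using lattice_periodic_const[of "\<lambda>k. fdiff i u v k j" k] per by simp
    then have "factor_periodic_flex p0 a edg (\<chi> i. 1) (fdiff i u)"
      by (simp add: factor_periodic_flex_def is_flex_fdiff[OF u])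
    then have "fdiff i u \<in> flexes_rig p0 a"
      by (intro factor) auto
    then obtain b where "\<And>v k j. fdiff i u v k j = b j"
      using per by (rule rig_periodic_const[OF sp]) blast
    then show ?thesis by blast
  qed
  then obtain b where b: "\<And>i v k j. fdiff i u v k j = b i j"
    using choice[of "\<lambda>i b. \<forall>v k j. fdiff i u v k j = b j"] by blast
  have affine: "u v k j = u v 0 j + (\<Sum>i\<in>UNIV. b i j * of_int (k $ i))" for v k j
  proof -
    \<comment> \<open>Removing the linear part with slopes \<open>b\<close> leaves a periodic
      function.\<close>
    define h where "h = (\<lambda>k. u v k j - (\<Sum>i\<in>UNIV. b i j * of_int (k $ i)))"
    have "h (k + axis i 1) = h k" for i k
    proof -
      have "(\<Sum>l\<in>UNIV. b l j * of_int ((k + axis i 1) $ l)) = (\<Sum>l\<in>UNIV. b l j * of_int (k $ l)) + b i j"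
        by (simp add: distrib_left sum.distrib axis_def if_distrib[of of_int] if_distrib[of "\<lambda>x. _ * x"] cong: if_cong)
      then show ?thesis
        using b[of i v k j] by (simp add: h_def fdiff_def algebra_simps)
    qed
    then have "h k = h 0"
      by (rule lattice_periodic_const)
    then show ?thesis
      by (simp add: h_def algebra_simps)
  qed
  have "flexible_lattice_periodic_flex p0 a edg u"
    unfolding flexible_lattice_periodic_flex_def
  proof (intro conjI exI[of _ "\<chi> j i. b i j"] allI u)
    show "u v k j = u v 0 j + (\<Sum>i\<in>UNIV. (\<chi> j i. b i j) $ j $ i * of_int (k $ i))" for v k j
      unfolding vec_lambda_beta by (rule affine)
  qed
  then show ?thesis
    by (rule flexible)
qed

lemma quadratic_flex_affine:
  assumes u: "is_flex p0 a edg u" and D: "\<And>i j l. fdiff i (fdiff j (fdiff l u)) = (\<lambda>v k m. 0)"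
  shows "fdiff i (fdiff j u) v k m = 0"
proof -
  have "fdiff j u \<in> flexes_rig p0 a" for j
    using D by (intro affine_flex_rigid is_flex_fdiff u)
  then obtain S b where S: "\<And>j. skew (S j)" "\<And>j. fdiff j u = crig p0 a (S j) (b j)"
    unfolding flexes_rig_iff by metis
  \<comment> \<open>The dot product of \<open>a n\<close> with \<open>S j\<close> applied to
    \<open>a i\<close>. Commuting differences make it symmetric in \<open>i\<close> and
    \<open>j\<close>; skewness of \<open>S j\<close> makes it skew in \<open>i\<close> and
    \<open>n\<close>.\<close>
  define A where "A = (\<lambda>i j n. \<Sum>m\<in>UNIV. (\<Sum>l\<in>UNIV. S j m l * complex_of_real (a i $ l)) * complex_of_real (a n $ m))"
  have DD: "fdiff i (fdiff j u) v k m = (\<Sum>l\<in>UNIV. S j m l * complex_of_real (a i $ l))" for i j m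
    by (simp add: S(2) fdiff_crig)
  have "A i j n = A j i n" for i j n
    unfolding A_def using fdiff_commute[of i j u] by (simp flip: DD)
  moreover have "A i j n = - A n j i" for i j n
  proof -
    have "A i j n = (\<Sum>l\<in>UNIV. \<Sum>m\<in>UNIV. S j m l * complex_of_real (a i $ l) * complex_of_real (a n $ m))"
      unfolding A_def sum_distrib_right by (rule sum.swap)
    also have "\<dots> = (\<Sum>l\<in>UNIV. \<Sum>m\<in>UNIV. - (S j l m * complex_of_real (a n $ m) * complex_of_real (a i $ l)))"
    proof (intro sum.cong refl)
      fix l m
      have "S j m l = - S j l m"
        using S(1) unfolding skew_def by blast
      then show "S j m l * complex_of_real (a i $ l) * complex_of_real (a n $ m)
          = - (S j l m * complex_of_real (a n $ m) * complex_of_real (a i $ l))"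
        by simp
    qed
    finally show ?thesis
      by (simp add: A_def sum_negf sum_distrib_right)
  qed
  ultimately have "A i j n = 0" for i j n
    by (rule symmetric_skew_zero)
  \<comment> \<open>The vector obtained from \<open>S j\<close> and \<open>a i\<close> is orthogonal
    to every lattice vector, hence zero.\<close>
  then have "(\<Sum>l\<in>UNIV. S j m l * complex_of_real (a i $ l)) = 0"
    unfolding A_def
    using lattice_orthogonal_zero[OF sp, of "\<lambda>m. \<Sum>l\<in>UNIV. S j m l * complex_of_real (a i $ l)" m] by blast
  then show ?thesis
    by (simp add: DD)
qed

end

text \<open>The exponent is negative because the pairing evaluates fields at \<open>-k\<close>:
  multiplying by this monomial translates fields forward.\<close>

abbreviation lshift :: "'d \<Rightarrow> 'd::finite laurent" where
  "lshift i \<equiv> Poly_Mapping.single (- axis i 1) 1"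

lemma wpair_lshift_diff: "wpair ((lshift i - Poly_Mapping.single 0 c) *s P) u
    = wpair P (\<lambda>v k j. u v (k + axis i 1) j - c * u v k j)"
  by (simp add: lm.scale_left_diff_distrib wpair_diff wpair_single wpair_field_diff wpair_field_scale)

text \<open>The functional taking a second difference at the lattice point 0. Its monomial multiples
  give the second differences at all other lattice points.\<close>

definition second_diff_gen :: "'d \<Rightarrow> 'd \<Rightarrow> 'v \<times> 'd \<Rightarrow> ('v::finite,'d::finite) lmod" where
  "second_diff_gen i j c = (lshift i - Poly_Mapping.single 0 1) *s
     ((lshift j - Poly_Mapping.single 0 1) *s axis c (Poly_Mapping.single 0 1))"

lemma wpair_second_diff_gen: "wpair (second_diff_gen i j (v,m)) u = fdiff j (fdiff i u) v 0 m"
  unfolding second_diff_gen_def wpair_lshift_diff wpair_axis fdiff_def by simp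

lemma wpair_second_diff_gen_translate:
  "wpair (Poly_Mapping.single (-k) 1 *s second_diff_gen i j (v,m)) u = fdiff j (fdiff i u) v k m"
  by (simp add: wpair_single wpair_second_diff_gen) (simp add: fdiff_def algebra_simps)

context no_special_flexes
begin

lemma second_diff_zero:
  assumes u0: "is_flex p0 a edg u0"
  shows "fdiff j (fdiff i u0) v k m = 0"
proof (rule ccontr)
  assume nz: "fdiff j (fdiff i u0) v k m \<noteq> 0"
  define G where "G = (\<lambda>(i,j,c). second_diff_gen i j c :: ('v,'d) lmod) ` UNIV"
  have finite_G: "finite G"
    by (simp add: G_def)
  \<comment> \<open>Otherwise a translate of the generator would lie in \<open>flexmod\<close> and
    pair to zero with the flex \<open>u0\<close>.\<close>
  have "second_diff_gen i j (v,m) \<notin> flexmod p0 a edg"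
  proof
    assume "second_diff_gen i j (v,m) \<in> flexmod p0 a edg"
    then have "Poly_Mapping.single (-k) 1 *s second_diff_gen i j (v,m) \<in> flexmod p0 a edg"
      by (rule lm.subspace_scale[OF subspace_flexmod])
    with u0 nz show False
      by (metis is_flex_iff_annihilates wpair_second_diff_gen_translate)
  qed
  moreover have "second_diff_gen i j (v,m) \<in> G"
    unfolding G_def by (rule image_eqI[of _ _ "(i,j,(v,m))"]) auto
  ultimately have "\<not> G \<subseteq> flexmod p0 a edg" by blast
  then obtain U w where U: "lm.subspace U" "flexmod p0 a edg \<subseteq> U" "\<not> G \<subseteq> U"
      and w: "\<And>l g. g \<in> G \<Longrightarrow> (lshift l - Poly_Mapping.single 0 (w l)) *s g \<in> U"
    using exists_eigenvalue_quotient[OF lm.module_axioms subspace_flexmod finite_G _ finite_class.finite_UNIV,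
        of p0 a edg lshift] by blast
  \<comment> \<open>\<open>lshift l\<close> is a unit of the Laurent ring, so it cannot carry all of
    \<open>G\<close> into \<open>U\<close>.\<close>
  have wnz: "w l \<noteq> 0" for l
  proof
    assume "w l = 0"
    have "g \<in> U" if "g \<in> G" for g
    proof -
      have "lshift l *s g \<in> U"
        using w[OF that, of l] \<open>w l = 0\<close> by simp
      then have "Poly_Mapping.single (axis l 1) 1 *s (lshift l *s g) \<in> U"
        by (rule lm.subspace_scale[OF U(1)])
      then show ?thesis
        by (simp add: mult_single)
    qed
    with U(3) show False by blast
  qed
  obtain i' j' v' m' where g: "second_diff_gen i' j' (v',m') \<notin> U"
    using U(3) by (auto simp: G_def)
  then obtain u where u: "\<And>P. P \<in> U \<Longrightarrow> wpair P u = 0" "wpair (second_diff_gen i' j' (v',m')) u = 1"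
    using exists_separating_field[OF lm_subspace_imp_lv[OF U(1)]] by blast
  have flex: "is_flex p0 a edg u"
    using u(1) U(2) by (auto simp: is_flex_iff_annihilates)
  \<comment> \<open>The eigenvalue relation modulo \<open>U\<close>, translated by a monomial and
    paired with \<open>u\<close>, turns into a relation between values of second
    differences.\<close>
  have eig: "fdiff j (fdiff i u) v (k + axis l 1) m = w l * fdiff j (fdiff i u) v k m" for i j l v k m
  proof -
    let ?g = "second_diff_gen i j (v,m)"
    have "?g \<in> G"
      unfolding G_def by (rule image_eqI[of _ _ "(i,j,(v,m))"]) auto
    then have "Poly_Mapping.single (-k) 1 *s ((lshift l - Poly_Mapping.single 0 (w l)) *s ?g) \<in> U"
      by (intro lm.subspace_scale[OF U(1)] w)
    then have "0 = wpair (Poly_Mapping.single (-k) 1 *s ((lshift l - Poly_Mapping.single 0 (w l)) *s ?g)) u"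
      using u(1) by simp
    also have "\<dots> = wpair (Poly_Mapping.single (-(k + axis l 1)) 1 *s ?g) u
        - w l * wpair (Poly_Mapping.single (-k) 1 *s ?g) u"
      by (simp add: lm.scale_left_diff_distrib right_diff_distrib wpair_diff wpair_single mult_single
        add.commute add.left_commute)
    finally show ?thesis
      by (simp add: wpair_second_diff_gen_translate del: minus_add_distrib)
  qed
  let ?f = "fdiff j' (fdiff i' u)"
  have f1: "?f v' 0 m' = 1"
    using u(2) by (simp add: wpair_second_diff_gen)
  show False
  proof (cases "\<forall>l. w l = 1")
    case True
    \<comment> \<open>With all eigenvalues 1, the second differences are periodic and the third ones
      vanish.\<close>
    then have "fdiff l (fdiff j (fdiff i u)) = (\<lambda>v k m. 0)" for l i j
      using eig by (simp add: fdiff_def[of l])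
    then have "?f v' 0 m' = 0"
      using quadratic_flex_affine[OF flex] by blast
    with f1 show False by simp
  next
    case False
    then obtain l where l: "w l \<noteq> 1" by blast
    have "?f v k m = mpow (\<chi> l. w l) k * ?f v 0 m" for v k m
      by (rule lattice_eigenfunction) (simp_all add: eig wnz)
    then have "factor_periodic_flex p0 a edg (\<chi> l. w l) ?f"
      unfolding factor_periodic_flex_def using flex by (blast intro: is_flex_fdiff)
    then have "?f \<in> flexes_rig p0 a"
      by (intro factor) (simp_all add: wnz)
    then have "?f v' 0 m' = 0"
      by (rule rig_factor_periodic_zero[OF _ l]) (rule eig)
    with f1 show False by simp
  qed
qed

lemma all_flexes_rigid: "flexes p0 a edg = flexes_rig p0 a"
proof -
  have "u \<in> flexes_rig p0 a" if "is_flex p0 a edg u" for u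
    by (intro affine_flex_rigid that ext second_diff_zero)
  then show ?thesis
    using flexes_rig_subset[of p0 a edg] by (auto simp: flexes_def)
qed

end

section \<open>Rank conditions\<close>

text \<open>Rank plus nullity over an arbitrary field. A basis of the row space is extended to the
  whole space and taken as the rows of an invertible matrix \<open>P\<close>; \<open>P\<close> maps
  the kernel of \<open>A\<close> onto a coordinate subspace.\<close>

lemma rank_plus_kernel_dim:
  fixes A :: "'a::field^'n^'m"
  shows "rank A + vec.dim {x. A *v x = 0} = CARD('n)"
proof -
  obtain B where B: "B \<subseteq> rows A" "vec.independent B" "rows A \<subseteq> vec.span B" "card B = rank A"
    using vec.basis_exists[of "rows A"] by (auto simp: row_rank_def_gen)
  define B' where "B' = vec.extend_basis B"
  have B': "B \<subseteq> B'" "vec.independent B'" "vec.span B' = UNIV"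
    using B(2) by (simp_all add: B'_def vec.extend_basis_superset vec.independent_extend_basis)
  have "finite B'"
    using B'(2) vec.finiteI_independent by blast
  moreover have "card B' = CARD('n)"
    using vec.dim_eq_card[of B' UNIV] B' vec_dim_card by (metis vec.span_UNIV)
  ultimately obtain h where h: "bij_betw h (UNIV :: 'n set) B'"
    using finite_same_card_bij[of "UNIV :: 'n set" B'] by auto
  define P :: "'a^'n^'n" where "P = (\<chi> i. h i)"
  define I where "I = {i. h i \<in> B}"
  have "rows P = B'"
    using h by (auto simp: rows_def row_def P_def bij_betw_def)
  then have "\<exists>Q. Q ** P = mat 1"
    using B'(3) by (simp add: matrix_left_invertible_span_rows_gen)
  then have inj: "inj ((*v) P)" and surj: "surj ((*v) P)"
    by (metis matrix_left_invertible_injective,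
        metis matrix_left_right_inverse matrix_right_invertible_surjective)
  have ker: "A *v x = 0 \<longleftrightarrow> (\<forall>i\<in>I. (P *v x) $ i = 0)" for x
  proof
    assume x: "A *v x = 0"
    show "\<forall>i\<in>I. (P *v x) $ i = 0"
    proof
      fix i assume "i \<in> I"
      then obtain r where "h i = row r A"
        using B(1) by (auto simp: I_def rows_def)
      then have "(P *v x) $ i = (A *v x) $ r"
        by (simp add: P_def matrix_vector_mult_def row_def)
      with x show "(P *v x) $ i = 0" by simp
    qed
  next
    assume x: "\<forall>i\<in>I. (P *v x) $ i = 0"
    \<comment> \<open>The vectors orthogonal to \<open>x\<close>. They form a subspace containing
      the basis \<open>B\<close>, hence every row of \<open>A\<close>.\<close>
    define N where "N = {r. (\<Sum>j\<in>UNIV. r $ j * x $ j) = 0}"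
    have "vec.subspace N"
      unfolding N_def
      by (rule vec.subspaceI) (simp_all add: distrib_right sum.distrib mult.assoc flip: sum_distrib_left)
    moreover have "B \<subseteq> N"
    proof
      fix r assume r: "r \<in> B"
      then obtain i where "h i = r"
        using h B'(1) by (metis bij_betw_imp_surj_on imageE subsetD)
      then have "(P *v x) $ i = 0"
        using x r by (auto simp: I_def)
      with \<open>h i = r\<close> show "r \<in> N"
        by (simp add: N_def P_def matrix_vector_mult_def)
    qed
    ultimately have "rows A \<subseteq> N"
      using B(3) vec.span_minimal by blast
    then have "row i A \<in> N" for i
      by (auto simp: rows_def)
    then show "A *v x = 0"
      by (simp add: N_def vec_eq_iff matrix_vector_mult_def row_def)
  qed
  have image: "(*v) P ` {x. A *v x = 0} = {y :: 'a^'n. \<forall>i. i \<notin> - I \<longrightarrow> y $ i = 0}"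
  proof (intro equalityI subsetI)
    fix y :: "'a^'n" assume y: "y \<in> {y. \<forall>i. i \<notin> - I \<longrightarrow> y $ i = 0}"
    obtain x where "y = P *v x" using surj by blast
    with y show "y \<in> (*v) P ` {x. A *v x = 0}"
      by (auto simp: ker)
  qed (auto simp: ker)
  have "vec.dim ((*v) P ` {x. A *v x = 0}) = vec.dim {x. A *v x = 0}"
    by (intro vec.dim_image_eq matrix_vector_mul_linear_gen inj_on_subset[OF inj]) simp
  then have "vec.dim {x. A *v x = 0} = card (- I)"
    unfolding image dim_substandard_cart by simp
  moreover have "card I = card B"
  proof -
    have "h ` I = B"
      using bij_betw_imp_surj_on[OF h] B'(1) unfolding I_def by blast
    then have "bij_betw h I B"
      using bij_betw_subset[OF h] by blast
    then show ?thesis by (rule bij_betw_same_card)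
  qed
  ultimately show ?thesis
    using B(4) card_Un_disjoint[of I "- I"] by (simp add: Compl_partition)
qed

text \<open>Common form of the three extremal rank conditions: \<open>K\<close> is the part of the
  kernel coming from rigid flexes, and the rank is extremal when nothing else is in the
  kernel.\<close>

lemma rank_eq_iff_kernel_eq:
  fixes A :: "'a::field^'n^'m"
  assumes K: "vec.subspace K" "K \<subseteq> {x. A *v x = 0}"
  shows "rank A + vec.dim K = CARD('n) \<longleftrightarrow> {x. A *v x = 0} \<subseteq> K"
proof -
  have "vec.subspace {x. A *v x = 0}"
    by (rule vec.subspace_kernel)
  then have "{x. A *v x = 0} \<subseteq> K \<longleftrightarrow> vec.dim K = vec.dim {x. A *v x = 0}"
    using vec.subspace_dim_equal[OF K(1) _ K(2)] K(2) by auto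
  then show ?thesis
    using rank_plus_kernel_dim[of A] by auto
qed

section \<open>Kernels of the matrices as spaces of flexes\<close>

definition eigenfield :: "complex^'d \<Rightarrow> complex^('v \<times> 'd) \<Rightarrow> ('v::finite,'d::finite) vfield" where
  "eigenfield w x = (\<lambda>v k j. mpow w k * x $ (v,j))"

lemma mpow_0 [simp]: "mpow w 0 = 1"
  by (simp add: mpow_def)

lemma mpow_add: "(\<And>i. w $ i \<noteq> 0) \<Longrightarrow> mpow w (k + l) = mpow w k * mpow w l"
  by (simp add: mpow_def power_int_add prod.distrib)

lemma mpow_inverse: "mpow (\<chi> i. inverse (w $ i)) (- k) = mpow w k"
  by (simp add: mpow_def power_int_minus power_int_inverse)

lemma mpow_nonzero: "(\<And>i. w $ i \<noteq> 0) \<Longrightarrow> mpow w k \<noteq> 0"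
  by (simp add: mpow_def)

lemma transfer_mult_component:
  assumes "edg e = ((v,k),(w,l))"
  shows "(transfer p0 a edg z *v x) $ e = (\<Sum>j\<in>UNIV. (mpow z (-k) * x $ (v,j) - mpow z (-l) * x $ (w,j))
    * complex_of_real ((pos p0 a v k - pos p0 a w l) $ j))"
proof -
  let ?p = "\<lambda>j. complex_of_real ((pos p0 a v k - pos p0 a w l) $ j)"
  have "(transfer p0 a edg z *v x) $ e
     = (\<Sum>c\<in>UNIV. (if fst c = v then ?p (snd c) * mpow z (-k) * x $ c else 0)
        - (if fst c = w then ?p (snd c) * mpow z (-l) * x $ c else 0))"
    unfolding matrix_vector_mult_def transfer_def
    by (simp add: assms) (intro sum.cong; auto simp: assms pedge_def algebra_simps)
  also have "\<dots> = (\<Sum>j\<in>UNIV. ?p j * mpow z (-k) * x $ (v,j)) - (\<Sum>j\<in>UNIV. ?p j * mpow z (-l) * x $ (w,j))"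
    unfolding sum_subtractf sum_UNIV_fst_delta by simp
  finally show ?thesis
    by (simp add: sum_subtractf[symmetric] algebra_simps)
qed

text \<open>The transfer function carries the exponents \<open>-k\<close>, so multi-factor
  \<open>w\<close> corresponds to evaluation at the coordinatewise inverse of \<open>w\<close>.
  Translating an edge only multiplies its equation by a nonzero power of \<open>w\<close>.\<close>

lemma is_flex_eigenfield_iff:
  assumes w: "\<And>i. w $ i \<noteq> 0"
  shows "is_flex p0 a edg (eigenfield w x) \<longleftrightarrow> transfer p0 a edg (\<chi> i. inverse (w $ i)) *v x = 0"
proof -
  have row: "wpair (Poly_Mapping.single t 1 *s lmrow p0 a (edg e)) (eigenfield w x)
      = mpow w (-t) * (transfer p0 a edg (\<chi> i. inverse (w $ i)) *v x) $ e" for t e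
  proof -
    obtain v k w' l where e: "edg e = ((v,k),(w',l))"
      by (metis surj_pair)
    have "(\<lambda>x' k j. eigenfield w x x' (k - t) j) = (\<lambda>x' k j. mpow w (-t) * eigenfield w x x' k j)"
      unfolding eigenfield_def using mpow_add[OF w, of _ "-t"] by (simp add: mult.assoc mult.left_commute)
    then have "wpair (Poly_Mapping.single t 1 *s lmrow p0 a (edg e)) (eigenfield w x)
       = mpow w (-t) * wpair (lmrow p0 a (edg e)) (eigenfield w x)"
      by (simp add: wpair_single wpair_field_scale)
    also have "wpair (lmrow p0 a (edg e)) (eigenfield w x) = (transfer p0 a edg (\<chi> i. inverse (w $ i)) *v x) $ e"
      unfolding e wpair_lmrow transfer_mult_component[of edg, OF e] eigenfield_def mpow_inverse ..
    finally show ?thesis .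
  qed
  show ?thesis
    unfolding is_flex_iff_wpair row using mpow_nonzero[OF w] by (auto simp: vec_eq_iff)
qed

text \<open>The minus sign matches the factors \<open>l - k\<close> in \<open>R_fper\<close>. Real
  parameters suffice here because \<open>R_fper\<close> is a real matrix.\<close>

definition affine_field :: "real^(('v \<times> 'd) + ('d \<times> 'd)) \<Rightarrow> ('v::finite,'d::finite) vfield" where
  "affine_field x = (\<lambda>v k j. complex_of_real (x $ Inl (v,j) - (\<Sum>i\<in>UNIV. of_int (k $ i) * x $ Inr (i,j))))"

lemma R_fper_mult_component:
  assumes "edg e = ((v,k),(w,l))"
  shows "(R_fper p0 a edg *v x) $ e = (\<Sum>j\<in>UNIV. ((x $ Inl (v,j) - x $ Inl (w,j))
     - (\<Sum>i\<in>UNIV. of_int (k $ i - l $ i) * x $ Inr (i,j))) * (pos p0 a v k - pos p0 a w l) $ j)"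
proof -
  let ?p = "\<lambda>j. (pos p0 a v k - pos p0 a w l) $ j"
  have "(R_fper p0 a edg *v x) $ e
     = (\<Sum>c\<in>UNIV. (if fst c = v then ?p (snd c) * x $ Inl c else 0) - (if fst c = w then ?p (snd c) * x $ Inl c else 0))
      + (\<Sum>i\<in>UNIV. \<Sum>j\<in>UNIV. of_int (l $ i - k $ i) * ?p j * x $ Inr (i,j))"
  proof -
    have "(\<Sum>c\<in>UNIV. R_fper p0 a edg $ e $ Inl c * x $ Inl c)
        = (\<Sum>c\<in>UNIV. (if fst c = v then ?p (snd c) * x $ Inl c else 0) - (if fst c = w then ?p (snd c) * x $ Inl c else 0))"
      by (intro sum.cong refl) (auto simp: R_fper_def assms pedge_def algebra_simps split: prod.splits)
    moreover have "(\<Sum>c\<in>UNIV. R_fper p0 a edg $ e $ Inr c * x $ Inr c)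
        = (\<Sum>i\<in>UNIV. \<Sum>j\<in>UNIV. of_int (l $ i - k $ i) * ?p j * x $ Inr (i,j))"
      unfolding sum_UNIV_prod by (simp add: R_fper_def assms pedge_def)
    ultimately show ?thesis
      by (simp add: matrix_vector_mult_def sum_UNIV_sum)
  qed
  also have "(\<Sum>c\<in>UNIV. (if fst c = v then ?p (snd c) * x $ Inl c else 0) - (if fst c = w then ?p (snd c) * x $ Inl c else 0))
      = (\<Sum>j\<in>UNIV. (x $ Inl (v,j) - x $ Inl (w,j)) * ?p j)"
    unfolding sum_subtractf sum_UNIV_fst_delta by (simp add: sum_subtractf[symmetric] algebra_simps)
  also have "(\<Sum>i\<in>UNIV. \<Sum>j\<in>UNIV. of_int (l $ i - k $ i) * ?p j * x $ Inr (i,j))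
      = (\<Sum>j\<in>UNIV. - (\<Sum>i\<in>UNIV. of_int (k $ i - l $ i) * x $ Inr (i,j)) * ?p j)"
  proof (subst sum.swap, intro sum.cong refl)
    fix j
    show "(\<Sum>i\<in>UNIV. of_int (l $ i - k $ i) * ?p j * x $ Inr (i,j))
        = - (\<Sum>i\<in>UNIV. of_int (k $ i - l $ i) * x $ Inr (i,j)) * ?p j"
      unfolding sum_negf[symmetric] sum_distrib_right by (intro sum.cong refl) (simp add: algebra_simps)
  qed
  finally show ?thesis
    by (simp add: sum.distrib[symmetric] left_diff_distrib)
qed

text \<open>The difference of an affine field across an edge does not change under translation, so
  one equation per motif edge remains.\<close>

lemma is_flex_affine_field_iff: "is_flex p0 a edg (affine_field x) \<longleftrightarrow> R_fper p0 a edg *v x = 0"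
proof -
  have row: "wpair (Poly_Mapping.single t 1 *s lmrow p0 a (edg e)) (affine_field x)
      = complex_of_real ((R_fper p0 a edg *v x) $ e)" for t e
  proof -
    obtain v k w l where e: "edg e = ((v,k),(w,l))"
      by (metis surj_pair)
    have "affine_field x v (k - t) j - affine_field x w (l - t) j
        = complex_of_real ((x $ Inl (v,j) - x $ Inl (w,j)) - (\<Sum>i\<in>UNIV. of_int (k $ i - l $ i) * x $ Inr (i,j)))" for j
      unfolding affine_field_def of_real_diff[symmetric]
      by (simp add: left_diff_distrib sum_subtractf)
    then show ?thesis
      unfolding e wpair_single wpair_lmrow R_fper_mult_component[of edg, OF e] by simp
  qed
  show ?thesis
    unfolding is_flex_iff_wpair row by (auto simp: vec_eq_iff)
qed

lemma flexible_affine_field: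
  assumes "is_flex p0 a edg (affine_field x)"
  shows "flexible_lattice_periodic_flex p0 a edg (affine_field x)"
  unfolding flexible_lattice_periodic_flex_def
proof (intro conjI exI[of _ "\<chi> j i. complex_of_real (- x $ Inr (i,j))"] allI assms)
  show "affine_field x v k j = affine_field x v 0 j
     + (\<Sum>i\<in>UNIV. (\<chi> j i. complex_of_real (- x $ Inr (i,j))) $ j $ i * of_int (k $ i))" for v k j
    by (simp add: affine_field_def sum_negf mult.commute)
qed

section \<open>Dimensions of the rigid parts of the kernels\<close>

definition translation_space :: "(complex^('v::finite \<times> 'd::finite)) set" where
  "translation_space = range (\<lambda>b :: complex^'d. \<chi> c. b $ snd c)"

lemma linear_vec_lambda_snd:
  "Vector_Spaces.linear (*s) (*s) (\<lambda>b :: 'a::field^'d. (\<chi> c. b $ snd c) :: 'a^('v::finite \<times> 'd))"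
  by unfold_locales (simp_all add: vec_eq_iff)

lemma dim_translation_space: "vec.dim (translation_space :: (complex^('v::finite \<times> 'd::finite)) set) = CARD('d)"
proof -
  have "inj (\<lambda>b :: complex^'d. (\<chi> c. b $ snd c) :: complex^('v \<times> 'd))"
    by (auto simp: inj_def vec_eq_iff)
  then show ?thesis
    unfolding translation_space_def
    using vec.dim_image_eq[OF linear_vec_lambda_snd, where S = UNIV] by (simp add: card_cart_basis)
qed

lemma subspace_translation_space: "vec.subspace (translation_space :: (complex^('v::finite \<times> 'd::finite)) set)"
  unfolding translation_space_def
  using vec.linear_subspace_image[OF linear_vec_lambda_snd vec.subspace_UNIV] .

lemma eigenfield_translation:
  assumes "x \<in> translation_space"
  shows "eigenfield (\<chi> i. 1) x \<in> flexes_rig p0 a"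
proof -
  obtain b where x: "x = (\<chi> c. b $ snd c)"
    using assms by (auto simp: translation_space_def)
  have "eigenfield (\<chi> i. 1) x = crig p0 a (\<lambda>_ _. 0) (\<lambda>j. b $ j)"
    by (simp add: eigenfield_def crig_def x)
  then show ?thesis
    unfolding flexes_rig_iff
    by (intro exI[of _ "\<lambda>_ _. 0"] exI[of _ "\<lambda>j. b $ j"]) (simp add: skew_def)
qed

definition rig_param :: "('v \<Rightarrow> real^'d) \<Rightarrow> ('d \<Rightarrow> real^'d) \<Rightarrow> ('d \<Rightarrow> 'd \<Rightarrow> real) \<Rightarrow> ('d \<Rightarrow> real)
    \<Rightarrow> real^(('v::finite \<times> 'd) + ('d::finite \<times> 'd))" where
  "rig_param p0 a S b = (\<chi> c. case c of
      Inl (v,j) \<Rightarrow> (\<Sum>l\<in>UNIV. S j l * p0 v $ l) + b j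
    | Inr (i,j) \<Rightarrow> - (\<Sum>l\<in>UNIV. S j l * a i $ l))"

lemma affine_field_rig_param:
  "affine_field (rig_param p0 a S b) = crig p0 a (\<lambda>i j. complex_of_real (S i j)) (\<lambda>j. complex_of_real (b j))"
proof (intro ext)
  fix v k j
  have "crig p0 a (\<lambda>i j. complex_of_real (S i j)) (\<lambda>j. complex_of_real (b j)) v k j
      = complex_of_real ((\<Sum>l\<in>UNIV. S j l * p0 v $ l) + b j
         + (\<Sum>i\<in>UNIV. (\<Sum>l\<in>UNIV. S j l * a i $ l) * of_int (k $ i)))"
    unfolding crig_affine[of _ _ _ _ _ k] by (simp add: crig_def pos_def)
  then show "affine_field (rig_param p0 a S b) v k j
      = crig p0 a (\<lambda>i j. complex_of_real (S i j)) (\<lambda>j. complex_of_real (b j)) v k j"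
    by (simp add: affine_field_def rig_param_def sum_negf mult.commute)
qed

definition rig_params :: "('v \<Rightarrow> real^'d) \<Rightarrow> ('d \<Rightarrow> real^'d) \<Rightarrow> (real^(('v::finite \<times> 'd) + ('d::finite \<times> 'd))) set" where
  "rig_params p0 a = {rig_param p0 a S b |S b. skew S}"

lemma rig_params_affine_field:
  assumes "x \<in> rig_params p0 a"
  shows "affine_field x \<in> flexes_rig p0 a"
proof -
  obtain S b where x: "x = rig_param p0 a S b" and S: "skew S"
    using assms by (auto simp: rig_params_def)
  have "skew (\<lambda>i j. complex_of_real (S i j))"
    using S unfolding skew_def of_real_minus[symmetric] by (metis)
  then show ?thesis
    unfolding x affine_field_rig_param flexes_rig_iff by blast
qed

text \<open>A rigid field may come with complex \<open>S\<close> and \<open>b\<close>, but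
  \<open>affine_field\<close> takes real values, so the real parts of \<open>S\<close> and
  \<open>b\<close> yield the same parameters.\<close>

lemma affine_field_rig_params:
  assumes "affine_field x \<in> flexes_rig p0 a"
  shows "x \<in> rig_params p0 a"
proof -
  obtain S b where S: "skew S" and eq: "affine_field x = crig p0 a S b"
    using assms by (auto simp: flexes_rig_iff)
  have 1: "complex_of_real (x $ Inl (v,j)) = (\<Sum>l\<in>UNIV. S j l * complex_of_real (p0 v $ l)) + b j" for v j
    using fun_cong[OF fun_cong[OF fun_cong[OF eq, of v], of 0], of j]
    by (simp add: affine_field_def crig_def pos_def)
  have 2: "complex_of_real (- x $ Inr (i,j)) = (\<Sum>l\<in>UNIV. S j l * complex_of_real (a i $ l))" for i j
  proof -
    \<comment> \<open>Differencing isolates the lattice block; the vertex \<open>undefined\<close>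
      stands for an arbitrary one.\<close>
    have "fdiff i (affine_field x) undefined 0 j = (\<Sum>l\<in>UNIV. S j l * complex_of_real (a i $ l))"
      unfolding eq by (rule fdiff_crig)
    moreover have "fdiff i (affine_field x) undefined 0 j = complex_of_real (- x $ Inr (i,j))"
      by (simp add: fdiff_def affine_field_def axis_def if_distrib[of of_int] if_distrib[of "\<lambda>x. x * _"] cong: if_cong)
    ultimately show ?thesis by simp
  qed
  have "skew (\<lambda>i j. Re (S i j))"
    using S unfolding skew_def uminus_complex.sel(1)[symmetric] by metis
  moreover have "x = rig_param p0 a (\<lambda>i j. Re (S i j)) (\<lambda>j. Re (b j))"
  proof -
    have "x $ Inl (v,j) = rig_param p0 a (\<lambda>i j. Re (S i j)) (\<lambda>j. Re (b j)) $ Inl (v,j)" for v j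
      using arg_cong[OF 1[of v j], of Re] by (simp add: rig_param_def)
    moreover have "x $ Inr (i,j) = rig_param p0 a (\<lambda>i j. Re (S i j)) (\<lambda>j. Re (b j)) $ Inr (i,j)" for i j
      using arg_cong[OF 2[of i j], of Re] by (simp add: rig_param_def)
    ultimately show ?thesis
      unfolding vec_eq_iff by (metis old.sum.exhaust surj_pair)
  qed
  ultimately show ?thesis
    by (auto simp: rig_params_def)
qed

text \<open>The strictly upper triangular entries parametrise the skew-symmetric matrices; an injection into
  the natural numbers replaces the missing order on the index type.\<close>

definition upper_pairs :: "('d::finite \<times> 'd) set" where
  "upper_pairs = {(p,q). to_nat_on (UNIV :: 'd set) p < to_nat_on (UNIV :: 'd set) q}"

lemma upper_pairs_cases:
  fixes p q :: "'d::finite"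
  obtains "p = q" "(p,q) \<notin> upper_pairs" "(q,p) \<notin> upper_pairs"
  | "p \<noteq> q" "(p,q) \<in> upper_pairs" "(q,p) \<notin> upper_pairs"
  | "p \<noteq> q" "(q,p) \<in> upper_pairs" "(p,q) \<notin> upper_pairs"
proof -
  have "inj (to_nat_on (UNIV :: 'd set))"
    by (intro inj_on_to_nat_on countable_finite) simp
  then show thesis
    using that unfolding upper_pairs_def
    by (cases "to_nat_on (UNIV :: 'd set) p" "to_nat_on (UNIV :: 'd set) q" rule: linorder_cases)
      (auto dest: injD)
qed

text \<open>The diagonal, the pairs in \<open>upper_pairs\<close> and their mirror images partition
  the square. The additive form avoids dividing natural numbers.\<close>

lemma card_upper_pairs: "CARD('d) * CARD('d) = CARD('d) + 2 * card (upper_pairs :: ('d::finite \<times> 'd) set)"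
proof -
  let ?U = "upper_pairs :: ('d \<times> 'd) set" and ?D = "range (\<lambda>p :: 'd. (p,p))"
  have eq: "UNIV = ?D \<union> (?U \<union> prod.swap ` ?U)"
  proof -
    have "(p,q) \<in> ?D \<union> (?U \<union> prod.swap ` ?U)" for p q :: 'd
      by (cases p q rule: upper_pairs_cases) (auto simp: image_iff intro: bexI[of _ "(q,p)"])
    then show ?thesis
      unfolding set_eq_iff split_paired_All by blast
  qed
  have 1: "?U \<inter> prod.swap ` ?U = {}" "?D \<inter> (?U \<union> prod.swap ` ?U) = {}"
    by (auto simp: upper_pairs_def)
  have "CARD('d) * CARD('d) = CARD('d \<times> 'd)" by simp
  also have "\<dots> = card ?D + (card ?U + card (prod.swap ` ?U))"
    unfolding eq using 1 by (subst card_Un_disjoint; simp add: card_Un_disjoint)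
  also have "card ?D = CARD('d)"
    by (intro card_image) (auto simp: inj_def)
  also have "card (prod.swap ` ?U) = card ?U"
    by (intro card_image) simp
  finally show ?thesis by simp
qed

definition rig_coords :: "('d::finite + 'd \<times> 'd) set" where
  "rig_coords = range Inl \<union> Inr ` upper_pairs"

lemma card_rig_coords: "card (rig_coords :: ('d::finite + 'd \<times> 'd) set) = CARD('d) + card (upper_pairs :: ('d \<times> 'd) set)"
  unfolding rig_coords_def by (subst card_Un_disjoint) (auto simp: card_image)

definition rig_of_coords :: "('v \<Rightarrow> real^'d) \<Rightarrow> ('d \<Rightarrow> real^'d) \<Rightarrow> real^('d + 'd \<times> 'd)
    \<Rightarrow> real^(('v::finite \<times> 'd) + ('d::finite \<times> 'd))" where
  "rig_of_coords p0 a y = rig_param p0 a (\<lambda>j l. y $ Inr (j,l) - y $ Inr (l,j)) (\<lambda>j. y $ Inl j)"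

lemma linear_rig_of_coords: "Vector_Spaces.linear (*s) (*s) (rig_of_coords p0 a)"
proof -
  have "rig_of_coords p0 a (x + y) $ c = (rig_of_coords p0 a x + rig_of_coords p0 a y) $ c"
    "rig_of_coords p0 a (r *s x) $ c = (r *s rig_of_coords p0 a x) $ c" for x y r c
    by (cases c; auto simp: rig_of_coords_def rig_param_def algebra_simps sum.distrib sum_subtractf sum_distrib_left)+
  then show ?thesis
    by unfold_locales (simp_all add: vec_eq_iff)
qed

text \<open>Every skew matrix is \<open>Y\<close> minus its transpose for a unique strictly upper
  triangular \<open>Y\<close>, whose entries serve as free coordinates.\<close>

lemma rig_params_eq_image:
  fixes p0 :: "'v::finite \<Rightarrow> real^'d::finite"
  shows "rig_params p0 a = rig_of_coords p0 a ` {y. \<forall>i. i \<notin> rig_coords \<longrightarrow> y $ i = 0}"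
proof (intro equalityI subsetI)
  fix x assume "x \<in> rig_params p0 a"
  then obtain S b where x: "x = rig_param p0 a S b" and S: "skew S"
    by (auto simp: rig_params_def)
  define y :: "real^('d + 'd \<times> 'd)" where
    "y = (\<chi> c. case c of Inl j \<Rightarrow> b j | Inr pq \<Rightarrow> if pq \<in> upper_pairs then S (fst pq) (snd pq) else 0)"
  have "y $ Inr (j,l) - y $ Inr (l,j) = S j l" for j l
  proof -
    have "S j l = - S l j" using S unfolding skew_def by blast
    then show ?thesis
      by (cases j l rule: upper_pairs_cases) (auto simp: y_def)
  qed
  then have "x = rig_of_coords p0 a y"
    unfolding x rig_of_coords_def by (simp add: y_def)
  moreover have "y $ i = 0" if "i \<notin> rig_coords" for i
    using that by (cases i) (auto simp: y_def rig_coords_def)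
  ultimately show "x \<in> rig_of_coords p0 a ` {y. \<forall>i. i \<notin> rig_coords \<longrightarrow> y $ i = 0}"
    by blast
qed (auto simp: rig_params_def rig_of_coords_def skew_def)

lemma subspace_supported: "vec.subspace {y :: 'a::field^'n. \<forall>i. i \<notin> D \<longrightarrow> y $ i = 0}"
  by (rule vec.subspaceI) auto

lemma subspace_rig_params: "vec.subspace (rig_params p0 a)"
  unfolding rig_params_eq_image by (rule vec.linear_subspace_image[OF linear_rig_of_coords subspace_supported])

lemma dim_rig_params:
  fixes p0 :: "'v::finite \<Rightarrow> real^'d::finite"
  assumes sp: "span (range a) = UNIV"
  shows "vec.dim (rig_params p0 a) = CARD('d) + card (upper_pairs :: ('d \<times> 'd) set)"
proof -
  let ?Z = "{y :: real^('d + 'd \<times> 'd). \<forall>i. i \<notin> rig_coords \<longrightarrow> y $ i = 0}"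
  interpret L: Vector_Spaces.linear "(*s)" "(*s)" "rig_of_coords p0 a"
    by (rule linear_rig_of_coords)
  have zero: "y = 0" if y: "y \<in> ?Z" "rig_of_coords p0 a y = 0" for y
  proof -
    have "(\<Sum>l\<in>UNIV. (y $ Inr (j,l) - y $ Inr (l,j)) * a i $ l) = 0" for i j
      using arg_cong[OF y(2), of "\<lambda>x. x $ Inr (i,j)"] by (simp add: rig_of_coords_def rig_param_def)
    then have S: "y $ Inr (j,l) - y $ Inr (l,j) = 0" for j l
      using lattice_orthogonal_zero_real[OF sp, of "\<lambda>l. y $ Inr (j,l) - y $ Inr (l,j)" l] by blast
    have low: "y $ Inr (p,q) = 0" if "(p,q) \<notin> upper_pairs" for p q
      using y(1) that by (auto simp: rig_coords_def)
    \<comment> \<open>The entries at \<open>(p,q)\<close> and \<open>(q,p)\<close> agree, and at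
      least one of the two pairs lies outside \<open>upper_pairs\<close>.\<close>
    have "y $ Inr (p,q) = 0" for p q
      using low[of p q] low[of q p] S[of p q] by (cases p q rule: upper_pairs_cases) auto
    moreover have "y $ Inl j = 0" for j
      using arg_cong[OF y(2), of "\<lambda>x. x $ Inl (undefined,j)"] S by (simp add: rig_of_coords_def rig_param_def)
    ultimately show ?thesis
      unfolding vec_eq_iff by (metis old.sum.exhaust surj_pair zero_index)
  qed
  have "inj_on (rig_of_coords p0 a) (vec.span ?Z)"
    unfolding vec.span_eq_iff[THEN iffD2, OF subspace_supported]
  proof (rule inj_onI)
    fix x y assume xy: "x \<in> ?Z" "y \<in> ?Z" "rig_of_coords p0 a x = rig_of_coords p0 a y"
    then have "rig_of_coords p0 a (x - y) = 0" "x - y \<in> ?Z"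
      by (auto simp: L.diff)
    then show "x = y" using zero[of "x - y"] by simp
  qed
  then have "vec.dim (rig_params p0 a) = vec.dim ?Z"
    unfolding rig_params_eq_image by (rule vec.dim_image_eq[OF linear_rig_of_coords])
  then show ?thesis
    unfolding dim_substandard_cart card_rig_coords .
qed

section \<open>Rank conditions expressed through flexes\<close>

lemma flexes_rig_add_scale:
  assumes "u \<in> flexes_rig p0 a" "u' \<in> flexes_rig p0 a"
  shows "(\<lambda>v k j. u v k j + c * u' v k j) \<in> flexes_rig p0 a"
proof -
  obtain S b S' b' where S: "skew S" "skew S'" "u = crig p0 a S b" "u' = crig p0 a S' b'"
    using assms by (auto simp: flexes_rig_iff)
  have "skew (\<lambda>i j. S i j + c * S' i j)"
    unfolding skew_def
  proof (intro allI)
    fix i j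
    have "S i j = - S j i" "S' i j = - S' j i"
      using S(1,2) unfolding skew_def by blast+
    then show "S i j + c * S' i j = - (S j i + c * S' j i)" by simp
  qed
  moreover have "(\<lambda>v k j. u v k j + c * u' v k j) = crig p0 a (\<lambda>i j. S i j + c * S' i j) (\<lambda>j. b j + c * b' j)"
    by (intro ext) (simp add: S crig_def distrib_left distrib_right sum.distrib sum_distrib_left mult.assoc)
  ultimately show ?thesis
    unfolding flexes_rig_iff by blast
qed

text \<open>The edge vectors are real, so the flex equations split into real and imaginary
  parts.\<close>

lemma is_flex_Re_Im:
  assumes "is_flex p0 a edg u"
  shows "is_flex p0 a edg (\<lambda>v k j. complex_of_real (Re (u v k j)))"
    and "is_flex p0 a edg (\<lambda>v k j. complex_of_real (Im (u v k j)))"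
proof -
  have eq: "(\<Sum>j\<in>UNIV. (u v (k+t) j - u w (l+t) j)
      * complex_of_real ((pos p0 a v (k+t) - pos p0 a w (l+t)) $ j)) = 0"
    if "edg e = ((v,k),(w,l))" for e v k w l t
    using assms that unfolding is_flex_def by blast
  show "is_flex p0 a edg (\<lambda>v k j. complex_of_real (Re (u v k j)))"
    unfolding is_flex_def
  proof (intro allI impI)
    fix e v k w l t assume "edg e = ((v,k),(w,l))"
    from arg_cong[OF eq[OF this, of t], of "\<lambda>z. complex_of_real (Re z)"]
    show "(\<Sum>j\<in>UNIV. (complex_of_real (Re (u v (k+t) j)) - complex_of_real (Re (u w (l+t) j)))
      * complex_of_real ((pos p0 a v (k+t) - pos p0 a w (l+t)) $ j)) = 0"
      by simp
  qed
  show "is_flex p0 a edg (\<lambda>v k j. complex_of_real (Im (u v k j)))"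
    unfolding is_flex_def
  proof (intro allI impI)
    fix e v k w l t assume "edg e = ((v,k),(w,l))"
    from arg_cong[OF eq[OF this, of t], of "\<lambda>z. complex_of_real (Im z)"]
    show "(\<Sum>j\<in>UNIV. (complex_of_real (Im (u v (k+t) j)) - complex_of_real (Im (u w (l+t) j)))
      * complex_of_real ((pos p0 a v (k+t) - pos p0 a w (l+t)) $ j)) = 0"
      by simp
  qed
qed

lemma factor_periodic_eigenfield:
  assumes "factor_periodic_flex p0 a edg w u"
  shows "u = eigenfield w (\<chi> c. u (fst c) 0 (snd c))"
proof (intro ext)
  fix v k j
  have "u v k j = mpow w k * u v 0 j"
    using assms unfolding factor_periodic_flex_def by blast
  then show "u v k j = eigenfield w (\<chi> c. u (fst c) 0 (snd c)) v k j"
    by (simp only: eigenfield_def vec_lambda_beta fst_conv snd_conv)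
qed

lemma eigenfield_factor_periodic:
  assumes "is_flex p0 a edg (eigenfield w x)"
  shows "factor_periodic_flex p0 a edg w (eigenfield w x)"
  using assms by (simp add: factor_periodic_flex_def eigenfield_def)

text \<open>For a multi-factor other than 1 the only rigid factor-periodic field is zero, so having
  no nontrivial ones means having trivial kernel.\<close>

lemma rank_transfer_generic_iff:
  fixes p0 :: "'v::finite \<Rightarrow> real^'d::finite"
  assumes w: "\<And>i. w $ i \<noteq> 0" "w \<noteq> (\<chi> i. 1)"
  shows "rank (transfer p0 a edg (\<chi> i. inverse (w $ i))) = CARD('d) * CARD('v) \<longleftrightarrow>
     (\<forall>u. factor_periodic_flex p0 a edg w u \<longrightarrow> u \<in> flexes_rig p0 a)"
proof -
  let ?A = "transfer p0 a edg (\<chi> i. inverse (w $ i))"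
  have "rank ?A + vec.dim ({0} :: (complex^('v \<times> 'd)) set) = CARD('v \<times> 'd) \<longleftrightarrow> {x. ?A *v x = 0} \<subseteq> {0}"
    by (rule rank_eq_iff_kernel_eq) (auto simp: vec.subspace_0)
  then have rank: "rank ?A = CARD('d) * CARD('v) \<longleftrightarrow> {x. ?A *v x = 0} \<subseteq> {0}"
    by (simp add: mult.commute)
  obtain i where i: "w $ i \<noteq> 1"
    using w(2) by (auto simp: vec_eq_iff)
  have 0: "(\<lambda>v k j. 0) \<in> flexes_rig p0 a"
    unfolding flexes_rig_iff
    by (intro exI[of _ "\<lambda>_ _. 0"] exI[of _ "\<lambda>_. 0"]) (simp add: skew_def crig_def)
  show ?thesis
    unfolding rank
  proof (intro iffI allI impI subsetI)
    fix u assume ker: "{x. ?A *v x = 0} \<subseteq> {0}" and u: "factor_periodic_flex p0 a edg w u"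
    let ?x = "\<chi> c. u (fst c) 0 (snd c)"
    have "is_flex p0 a edg (eigenfield w ?x)"
      using u factor_periodic_eigenfield[OF u] by (metis factor_periodic_flex_def)
    then have "?x = 0"
      using ker by (auto simp: is_flex_eigenfield_iff[OF w(1)])
    then have "u = (\<lambda>v k j. 0)"
      using factor_periodic_eigenfield[OF u] by (simp add: eigenfield_def)
    then show "u \<in> flexes_rig p0 a" using 0 by simp
  next
    fix x assume rig: "\<forall>u. factor_periodic_flex p0 a edg w u \<longrightarrow> u \<in> flexes_rig p0 a"
      and x: "x \<in> {x. ?A *v x = 0}"
    have "eigenfield w x \<in> flexes_rig p0 a"
      using rig x eigenfield_factor_periodic is_flex_eigenfield_iff[OF w(1)] by blast
    then have "eigenfield w x v 0 j = 0" for v j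
    proof (rule rig_factor_periodic_zero[OF _ i])
      show "eigenfield w x v (k + axis i 1) j = w $ i * eigenfield w x v k j" for v k j
      proof -
        have "mpow w (axis i 1) = w $ i"
          unfolding mpow_def axis_def by (simp add: if_distrib[of "\<lambda>n. _ powi n"] cong: if_cong)
        then show ?thesis
          by (simp add: eigenfield_def mpow_add[OF w(1)])
      qed
    qed
    then show "x \<in> {0}"
      by (simp add: eigenfield_def vec_eq_iff)
  qed
qed

text \<open>The periodic rigid fields are the translations, a \<open>d\<close>-dimensional space
  always contained in the kernel.\<close>

lemma rank_transfer_one_iff:
  fixes p0 :: "'v::finite \<Rightarrow> real^'d::finite"
  assumes sp: "span (range a) = UNIV"
  shows "rank (transfer p0 a edg (\<chi> i. 1)) = CARD('d) * CARD('v) - CARD('d) \<longleftrightarrow>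
     (\<forall>u. factor_periodic_flex p0 a edg (\<chi> i. 1) u \<longrightarrow> u \<in> flexes_rig p0 a)"
proof -
  let ?A = "transfer p0 a edg (\<chi> i. 1)" and ?w = "(\<chi> i. 1) :: complex^'d"
  have flex: "is_flex p0 a edg (eigenfield ?w x) \<longleftrightarrow> ?A *v x = 0" for x
    using is_flex_eigenfield_iff[of ?w p0 a edg x] by simp
  have "translation_space \<subseteq> {x. ?A *v x = 0}"
    using eigenfield_translation[of _ p0 a] flexes_rig_subset[of p0 a edg] by (auto simp: flexes_def simp flip: flex)
  then have "rank ?A + CARD('d) = CARD('v \<times> 'd) \<longleftrightarrow> {x. ?A *v x = 0} \<subseteq> translation_space"
    using rank_eq_iff_kernel_eq[OF subspace_translation_space] by (metis dim_translation_space)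
  \<comment> \<open>Ensures that the natural number subtraction in the rank condition is not
    truncated.\<close>
  moreover have "CARD('d) * CARD('v) \<ge> CARD('d)" by simp
  ultimately have rank: "rank ?A = CARD('d) * CARD('v) - CARD('d) \<longleftrightarrow> {x. ?A *v x = 0} \<subseteq> translation_space"
    by (auto simp: mult.commute)
  show ?thesis
    unfolding rank
  proof (intro iffI allI impI subsetI)
    fix u assume ker: "{x. ?A *v x = 0} \<subseteq> translation_space" and u: "factor_periodic_flex p0 a edg ?w u"
    let ?x = "\<chi> c. u (fst c) 0 (snd c)"
    have "is_flex p0 a edg (eigenfield ?w ?x)"
      using u factor_periodic_eigenfield[OF u] by (metis factor_periodic_flex_def)
    then have "?x \<in> translation_space"
      using ker flex by blast
    then show "u \<in> flexes_rig p0 a"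
      using factor_periodic_eigenfield[OF u] eigenfield_translation by metis
  next
    fix x assume rig: "\<forall>u. factor_periodic_flex p0 a edg ?w u \<longrightarrow> u \<in> flexes_rig p0 a"
      and x: "x \<in> {x. ?A *v x = 0}"
    have "eigenfield ?w x \<in> flexes_rig p0 a"
      using rig x eigenfield_factor_periodic flex by blast
    then obtain b where b: "\<And>v k j. eigenfield ?w x v k j = b j"
      by (rule rig_periodic_const[OF sp]) (auto simp: eigenfield_def)
    then have "x = (\<chi> c. (\<chi> j. b j) $ snd c)"
      by (auto simp: eigenfield_def vec_eq_iff)
    then show "x \<in> translation_space"
      unfolding translation_space_def by blast
  qed
qed

text \<open>The rigid parameters have dimension \<open>d + d(d-1)/2\<close> among
  \<open>dn + d^2\<close> columns, which leaves the stated rank.\<close>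

lemma rank_R_fper_iff:
  fixes p0 :: "'v::finite \<Rightarrow> real^'d::finite"
  assumes sp: "span (range a) = UNIV"
  shows "rank (R_fper p0 a edg) = CARD('d) * CARD('v) + CARD('d) * (CARD('d) - 1) div 2 \<longleftrightarrow>
     (\<forall>u. flexible_lattice_periodic_flex p0 a edg u \<longrightarrow> u \<in> flexes_rig p0 a)"
proof -
  let ?A = "R_fper p0 a edg" and ?N = "card (upper_pairs :: ('d \<times> 'd) set)"
  have "rig_params p0 a \<subseteq> {x. ?A *v x = 0}"
    using rig_params_affine_field[of _ p0 a] flexes_rig_subset[of p0 a edg]
    by (auto simp: flexes_def simp flip: is_flex_affine_field_iff)
  then have "rank ?A + (CARD('d) + ?N) = CARD(('v \<times> 'd) + ('d \<times> 'd)) \<longleftrightarrow> {x. ?A *v x = 0} \<subseteq> rig_params p0 a"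
    using rank_eq_iff_kernel_eq[OF subspace_rig_params] by (metis dim_rig_params[OF sp])
  moreover have "CARD('d) * CARD('d) = CARD('d) + 2 * ?N"
    by (rule card_upper_pairs)
  moreover from this have "CARD('d) * (CARD('d) - 1) = 2 * ?N"
    by (simp add: right_diff_distrib')
  ultimately have rank: "rank ?A = CARD('d) * CARD('v) + CARD('d) * (CARD('d) - 1) div 2
      \<longleftrightarrow> {x. ?A *v x = 0} \<subseteq> rig_params p0 a"
    by (auto simp: mult.commute)
  show ?thesis
    unfolding rank
  proof (intro iffI allI impI subsetI)
    fix x assume rig: "\<forall>u. flexible_lattice_periodic_flex p0 a edg u \<longrightarrow> u \<in> flexes_rig p0 a"
      and x: "x \<in> {x. ?A *v x = 0}"
    then have "is_flex p0 a edg (affine_field x)"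
      by (simp add: is_flex_affine_field_iff)
    then show "x \<in> rig_params p0 a"
      using rig flexible_affine_field affine_field_rig_params by blast
  next
    fix u assume ker: "{x. ?A *v x = 0} \<subseteq> rig_params p0 a" and "flexible_lattice_periodic_flex p0 a edg u"
    then obtain X :: "complex^'d^'d" where flex: "is_flex p0 a edg u"
      and X: "\<And>v k j. u v k j = u v 0 j + (\<Sum>i\<in>UNIV. X $ j $ i * of_int (k $ i))"
      unfolding flexible_lattice_periodic_flex_def by blast
    have rig: "affine_field x \<in> flexes_rig p0 a" if "is_flex p0 a edg (affine_field x)" for x
      using that ker rig_params_affine_field by (auto simp: is_flex_affine_field_iff)
    \<comment> \<open>\<open>R_fper\<close> only sees real fields, so the complex flex is handled
      through its real and imaginary parts and recombined.\<close>
    define xr :: "real^(('v \<times> 'd) + ('d \<times> 'd))" where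
      "xr = (\<chi> c. case c of Inl (v,j) \<Rightarrow> Re (u v 0 j) | Inr (i,j) \<Rightarrow> - Re (X $ j $ i))"
    define xi :: "real^(('v \<times> 'd) + ('d \<times> 'd))" where
      "xi = (\<chi> c. case c of Inl (v,j) \<Rightarrow> Im (u v 0 j) | Inr (i,j) \<Rightarrow> - Im (X $ j $ i))"
    have r: "affine_field xr = (\<lambda>v k j. complex_of_real (Re (u v k j)))"
    proof (intro ext)
      fix v k j
      show "affine_field xr v k j = complex_of_real (Re (u v k j))"
        by (subst X) (simp add: affine_field_def xr_def sum_negf mult.commute)
    qed
    have i: "affine_field xi = (\<lambda>v k j. complex_of_real (Im (u v k j)))"
    proof (intro ext)
      fix v k j
      show "affine_field xi v k j = complex_of_real (Im (u v k j))"
        by (subst X) (simp add: affine_field_def xi_def sum_negf mult.commute)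
    qed
    have "(\<lambda>v k j. affine_field xr v k j + \<i> * affine_field xi v k j) \<in> flexes_rig p0 a"
      using is_flex_Re_Im[OF flex] by (intro flexes_rig_add_scale rig) (simp_all add: r i)
    also have "(\<lambda>v k j. affine_field xr v k j + \<i> * affine_field xi v k j) = u"
      by (intro ext) (simp add: r i complex_eq_iff)
    finally show "u \<in> flexes_rig p0 a" .
  qed
qed

text \<open>Exponential rigidity lies between (i) and (iii): rigid fields are exponential, and so
  are the two special kinds of flexes in (iii).\<close>

theorem theorem3p2:
  fixes p0 :: "'v::finite \<Rightarrow> real^'d::finite"
    and a :: "'d \<Rightarrow> real^'d"
    and edg :: "'e::finite \<Rightarrow> ('v,'d) medge"
  assumes d2: "CARD('d) \<ge> 2"
    and cf: "crystal_framework p0 a edg"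
  defines "ci \<equiv> (flexes p0 a edg = flexes_rig p0 a)"
    and "cii \<equiv> (flexes_exp p0 a edg = flexes_rig p0 a)"
    and "ciii \<equiv> ((\<forall>w u. (\<forall>i. w$i \<noteq> 0) \<and> factor_periodic_flex p0 a edg w u
                        \<longrightarrow> u \<in> flexes_rig p0 a) \<and>
                 (\<forall>u. flexible_lattice_periodic_flex p0 a edg u \<longrightarrow> u \<in> flexes_rig p0 a))"
    and "civ \<equiv> ((\<forall>z. (\<forall>i. z$i \<noteq> 0) \<and> z \<noteq> (\<chi> i. 1) \<longrightarrow>
                      rank (transfer p0 a edg z) = CARD('d) * CARD('v)) \<and>
                rank (transfer p0 a edg (\<chi> i. 1)) = CARD('d) * CARD('v) - CARD('d) \<and>
                rank (R_fper p0 a edg) = CARD('d) * CARD('v) + CARD('d) * (CARD('d) - 1) div 2)"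
    and "cv \<equiv> (module_C p0 a edg = module_rig p0 a)"
  shows "(ci \<longleftrightarrow> cii) \<and> (ci \<longleftrightarrow> ciii) \<and> (ci \<longleftrightarrow> civ) \<and> (ci \<longleftrightarrow> cv)"
proof -
  have sp: "span (range a) = UNIV"
    using cf by (intro span_lattice_vectors) (auto simp: crystal_framework_def)
  have "ci \<longleftrightarrow> cv"
    unfolding ci_def cv_def by (rule flex_rig_iff_module_eq)
  moreover have "cii" if ci
    using that flexes_rig_in_V_exp unfolding ci_def cii_def flexes_exp_def by blast
  moreover have "ciii" if cii
  proof -
    have exp: "u \<in> flexes_rig p0 a" if "u \<in> V_exp" "is_flex p0 a edg u" for u
      using \<open>cii\<close> that unfolding cii_def flexes_exp_def flexes_def by blast
    show ?thesis
      unfolding ciii_def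
    proof (intro conjI allI impI; (elim conjE)?)
      fix w :: "complex^'d" and u :: "('v,'d) vfield"
      assume "\<forall>i. w $ i \<noteq> 0" and u: "factor_periodic_flex p0 a edg w u"
      then have "u \<in> V_exp"
        unfolding factor_periodic_flex_def by (intro factor_periodic_in_V_exp[of u w]) blast+
      with u show "u \<in> flexes_rig p0 a"
        using exp unfolding factor_periodic_flex_def by blast
    next
      fix u :: "('v,'d) vfield"
      assume u: "flexible_lattice_periodic_flex p0 a edg u"
      then obtain X :: "complex^'d^'d"
        where "\<And>v k j. u v k j = u v 0 j + (\<Sum>i\<in>UNIV. X $ j $ i * of_int (k $ i))"
        unfolding flexible_lattice_periodic_flex_def by blast
      then have "u \<in> V_exp"
        by (rule affine_in_V_exp[of u "\<lambda>v j. u v 0 j" "\<lambda>j i. X $ j $ i"])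
      with u show "u \<in> flexes_rig p0 a"
        using exp unfolding flexible_lattice_periodic_flex_def by blast
    qed
  qed
  moreover have "ci" if ciii
  proof -
    interpret no_special_flexes p0 a edg
      using that sp unfolding ciii_def by unfold_locales blast+
    show ?thesis
      unfolding ci_def by (rule all_flexes_rigid)
  qed
  moreover have "ciii \<longleftrightarrow> civ"
  proof -
    \<comment> \<open>Coordinatewise inversion permutes the admissible points other than 1, which
      reconciles evaluation points with multi-factors.\<close>
    have inverse_all: "(\<forall>z. (\<forall>i. z $ i \<noteq> 0) \<and> z \<noteq> (\<chi> i. 1) \<longrightarrow> Q z) \<longleftrightarrow>
        (\<forall>w. (\<forall>i. w $ i \<noteq> 0) \<and> w \<noteq> (\<chi> i. 1) \<longrightarrow> Q (\<chi> i. inverse (w $ i)))"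
      for Q :: "complex^'d \<Rightarrow> bool"
    proof (intro iffI allI impI)
      fix w :: "complex^'d"
      assume *: "\<forall>z. (\<forall>i. z $ i \<noteq> 0) \<and> z \<noteq> (\<chi> i. 1) \<longrightarrow> Q z" and w: "(\<forall>i. w $ i \<noteq> 0) \<and> w \<noteq> (\<chi> i. 1)"
      show "Q (\<chi> i. inverse (w $ i))"
        using w by (intro *[rule_format]) (auto simp: vec_eq_iff)
    next
      fix z :: "complex^'d"
      assume *: "\<forall>w. (\<forall>i. w $ i \<noteq> 0) \<and> w \<noteq> (\<chi> i. 1) \<longrightarrow> Q (\<chi> i. inverse (w $ i))"
        and z: "(\<forall>i. z $ i \<noteq> 0) \<and> z \<noteq> (\<chi> i. 1)"
      have "Q (\<chi> i. inverse ((\<chi> i. inverse (z $ i)) $ i))"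
        using z by (intro *[rule_format]) (auto simp: vec_eq_iff)
      then show "Q z" by simp
    qed
    have "(\<forall>w. (\<forall>i. w $ i \<noteq> 0) \<and> w \<noteq> (\<chi> i. 1) \<longrightarrow>
          rank (transfer p0 a edg (\<chi> i. inverse (w $ i))) = CARD('d) * CARD('v)) \<longleftrightarrow>
        (\<forall>w. (\<forall>i. w $ i \<noteq> 0) \<and> w \<noteq> (\<chi> i. 1) \<longrightarrow>
          (\<forall>u. factor_periodic_flex p0 a edg w u \<longrightarrow> u \<in> flexes_rig p0 a))"
      using rank_transfer_generic_iff[of _ p0 a edg] by simp
    moreover have "\<forall>i. ((\<chi> i. 1) :: complex^'d) $ i \<noteq> 0"
      by simp
    ultimately show ?thesis
      using inverse_all[of "\<lambda>z. rank (transfer p0 a edg z) = CARD('d) * CARD('v)"]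
      unfolding ciii_def civ_def rank_transfer_one_iff[OF sp] rank_R_fper_iff[OF sp]
      by blast
  qed
  ultimately show ?thesis by blast
qed

end
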